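(* Let $\mathcal K=\mathcal K'\cup_\sigma\Delta^n$ be a simplicial complex obtained from a nonempty simplicial complex $\mathcal K'$ by gluing an $n$-simplex $\Delta^n$ along a proper, possibly empty, face $\sigma\in\mathcal K'$ (that is, $\sigma$ is a simplex of $\mathcal K'$ identified with a proper, possibly empty, face of $\Delta^n$, and $\mathcal K'\cap\Delta^n=\sigma$ together with its faces). Then either $\mathcal K$ is a simplex, or $$\mathit{HH}^{-k,2\ell}(\mathcal Z_{\mathcal K})=\begin{cases}\mathbb Z & \text{for }(-k,2\ell)=(0,0),\ (-1,4);\\ 0&\text{otherwise.}\end{cases}$$
   Context: A simplicial complex $\mathcal K$ on the vertex set $[m]=\{1,\dots,m\}$ is a collection of subsets of $[m]$ closed under passing to subsets and containing $\varnothing$ and all singletons; "nonempty" means having at least one vertex. $\mathcal K$ is a simplex if every subset of its vertex set is in $\mathcal K$. For $I\subset[m]$ the full subcomplex is $\mathcal K_I=\{J\in\mathcal K: J\subset I\}$. All (co)homology has $\mathbb Z$ coefficients; $\widetilde H^*$ is reduced simplicial cohomology, with $\widetilde H^{-1}(\mathcal K_\varnothing)=\mathbb Z$. Moment-angle complex: $\mathcal Z_{\mathcal K}=\bigcup_{I\in\mathcal K}\{z\in(D^2)^m: |z_j|=1\text{ if }j\notin I\}$. Its cohomology has the bigraded Hochster decomposition $H^{-k,2\ell}(\mathcal Z_{\mathcal K})=\bigoplus_{I\subset[m],|I|=\ell}\widetilde H^{\ell-k-1}(\mathcal K_I)$, of total degree $-k+2\ell$. Double cohomology: for $i\in I$ let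 $\psi_{p;i,I}:\widetilde H^p(\mathcal K_I)\to\widetilde H^p(\mathcal K_{I\setminus\{i\}})$ be induced by inclusion, let $\varepsilon(i,I)=(-1)^{\#\{r\in I: r<i\}}$, and define $d'$ on $\widetilde H^p(\mathcal K_I)$ by $d'=(-1)^{p+1}\sum_{i\in I}\varepsilon(i,I)\psi_{p;i,I}$. Then $d':H^{-k,2\ell}(\mathcal Z_{\mathcal K})\to H^{-k+1,2\ell-2}(\mathcal Z_{\mathcal K})$, $(d')^2=0$, and $\mathit{HH}^{-k,2\ell}(\mathcal Z_{\mathcal K})$ denotes the cohomology of $(H^*(\mathcal Z_{\mathcal K}),d')$ at bidegree $(-k,2\ell)$. For a complex on another finite vertex set, choose any ordering of the vertices. *)

theory Defs
  imports "HOL-Algebra.Product_Groups" "HOL-Algebra.FiniteProduct"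
begin

text \<open>All cohomology is with integer coefficients.  Groups are those of HOL-Algebra, hence written
  multiplicatively; in particular the integers are \<^const>\<open>integer_group\<close>, and multiplication of a
  class by a sign is an integer power.  Vertices come from a linearly ordered type.\<close>

subsection \<open>Simplicial complexes\<close>

definition simplicial_complex_on :: "'a set \<Rightarrow> 'a set set \<Rightarrow> bool" where
  "simplicial_complex_on V K \<longleftrightarrow>
     finite V \<and> K \<subseteq> Pow V \<and> {} \<in> K \<and> (\<forall>v\<in>V. {v} \<in> K) \<and> (\<forall>s\<in>K. \<forall>t. t \<subseteq> s \<longrightarrow> t \<in> K)"

definition is_simplex_on :: "'a set \<Rightarrow> 'a set set \<Rightarrow> bool" where
  "is_simplex_on V K \<longleftrightarrow> (\<forall>s. s \<subseteq> V \<longrightarrow> s \<in> K)"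

definition full_subcomplex :: "'a set set \<Rightarrow> 'a set \<Rightarrow> 'a set set" where
  "full_subcomplex K I = {J \<in> K. J \<subseteq> I}"

definition vertex_sign :: "'a::linorder \<Rightarrow> 'a set \<Rightarrow> int" where
  "vertex_sign i I = (-1) ^ card {r \<in> I. r < i}"


subsection \<open>Reduced simplicial cohomology\<close>

text \<open>The group \<open>ker g / im f\<close> of a pair of composable homomorphisms \<open>A \<rightarrow> B \<rightarrow> C\<close>
  with trivial composite.\<close>

definition middle_cohomology ::
  "('a, 'm) monoid_scheme \<Rightarrow> ('a \<Rightarrow> 'b) \<Rightarrow> ('b, 'n) monoid_scheme \<Rightarrow> ('b \<Rightarrow> 'c) \<Rightarrow>
   ('c, 'k) monoid_scheme \<Rightarrow> 'b set monoid" where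
  "middle_cohomology A f B g C = subgroup_generated B (kernel B C g) Mod (f ` carrier A)"

text \<open>Dimensions are integers.  The empty simplex has dimension \<open>-1\<close>, which makes the cochain complex
  below the augmented one, and there are no simplices in dimensions below \<open>-1\<close>.\<close>

definition simplices :: "int \<Rightarrow> 'a set set \<Rightarrow> 'a set set" where
  "simplices p K = {s \<in> K. int (card s) = p + 1}"

definition cochain_group :: "int \<Rightarrow> 'a set set \<Rightarrow> ('a set \<Rightarrow> int) monoid" where
  "cochain_group p K = product_group (simplices p K) (\<lambda>_. integer_group)"

definition coboundary :: "int \<Rightarrow> 'a::linorder set set \<Rightarrow> ('a set \<Rightarrow> int) \<Rightarrow> ('a set \<Rightarrow> int)" where
  "coboundary p K f = (\<lambda>t\<in>simplices (p + 1) K. \<Sum>v\<in>t. vertex_sign v t * f (t - {v}))"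

definition reduced_cohomology ::
  "int \<Rightarrow> 'a::linorder set set \<Rightarrow> ('a set \<Rightarrow> int) set monoid" where
  "reduced_cohomology p K =
     middle_cohomology (cochain_group (p - 1) K) (coboundary (p - 1) K)
                       (cochain_group p K) (coboundary p K) (cochain_group (p + 1) K)"

text \<open>The map on cohomology induced by the inclusion of a subcomplex \<open>L\<close>.  A class, being a coset
  \<open>c\<close> of cocycles, is sent to the class of the restriction of any of its members; all the cosets
  in the union are equal.\<close>

definition induced_restriction ::
  "int \<Rightarrow> 'a::linorder set set \<Rightarrow> ('a set \<Rightarrow> int) set \<Rightarrow> ('a set \<Rightarrow> int) set" where
  "induced_restriction p L c =
     (\<Union>f\<in>c. (coboundary (p - 1) L ` carrier (cochain_group (p - 1) L))
               #>\<^bsub>cochain_group p L\<^esub> restrict f (simplices p L))"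


subsection \<open>Double cohomology of moment-angle complexes\<close>

definition vertex_subsets :: "'a set \<Rightarrow> int \<Rightarrow> 'a set set" where
  "vertex_subsets V l = {I. I \<subseteq> V \<and> int (card I) = l}"

text \<open>The bigraded component \<open>H\<^sup>-\<^sup>k\<^sup>,\<^sup>2\<^sup>l\<close> of the cohomology of the moment-angle complex of a
  complex \<open>K\<close> on \<open>V\<close>, given by its Hochster decomposition.\<close>

definition moment_angle_cohomology ::
  "'a::linorder set \<Rightarrow> 'a set set \<Rightarrow> int \<Rightarrow> int \<Rightarrow> ('a set \<Rightarrow> ('a set \<Rightarrow> int) set) monoid" where
  "moment_angle_cohomology V K k l =
     sum_group (vertex_subsets V l) (\<lambda>I. reduced_cohomology (l - k - 1) (full_subcomplex K I))"

text \<open>The differential from bidegree \<open>(-k, 2l)\<close> to \<open>(-k+1, 2l-2)\<close>.  On the summand indexed by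
  \<open>I\<close> it is \<open>(-1)\<^sup>p\<^sup>+\<^sup>1 \<Sum>i\<in>I. \<epsilon>(i,I) \<psi>\<^sub>i\<close>, where \<open>p = l - k - 1\<close> and \<open>\<psi>\<^sub>i\<close> is the restriction
  to the full subcomplex on \<open>I - {i}\<close>.  Hence its component at \<open>J\<close> collects the contributions of
  all \<open>I = insert i J\<close> with \<open>i \<in> V - J\<close>.  The groups vanish for \<open>p < -1\<close>, so that the
  truncation in \<open>nat (p + 1)\<close> is harmless.\<close>

definition double_differential ::
  "'a::linorder set \<Rightarrow> 'a set set \<Rightarrow> int \<Rightarrow> int \<Rightarrow>
   ('a set \<Rightarrow> ('a set \<Rightarrow> int) set) \<Rightarrow> ('a set \<Rightarrow> ('a set \<Rightarrow> int) set)" where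
  "double_differential V K k l x =
     (let p = l - k - 1 in
      (\<lambda>J\<in>vertex_subsets V (l - 1).
        finprod (reduced_cohomology p (full_subcomplex K J))
          (\<lambda>i. induced_restriction p (full_subcomplex K J) (x (insert i J))
                 [^]\<^bsub>reduced_cohomology p (full_subcomplex K J)\<^esub>
                 ((-1) ^ nat (p + 1) * vertex_sign i (insert i J)))
          (V - J)))"

text \<open>\<open>HH\<^sup>-\<^sup>k\<^sup>,\<^sup>2\<^sup>l\<close> of the moment-angle complex.\<close>

definition double_cohomology ::
  "'a::linorder set \<Rightarrow> 'a set set \<Rightarrow> int \<Rightarrow> int \<Rightarrow> ('a set \<Rightarrow> ('a set \<Rightarrow> int) set) set monoid" where
  "double_cohomology V K k l =
     middle_cohomology
       (moment_angle_cohomology V K (k + 1) (l + 1)) (double_differential V K (k + 1) (l + 1))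
       (moment_angle_cohomology V K k l) (double_differential V K k l)
       (moment_angle_cohomology V K (k - 1) (l - 1))"

end

theory Submission
  imports Defs
begin

text \<open>
  A vertex \<open>v\<close> of the glued simplex outside \<open>\<sigma>\<close> has a star consisting of a single simplex
  \<open>insert v S\<close> with its faces, where \<open>S = D - {v}\<close>. The argument computes the double cohomology of
  any complex that has such a vertex, provided some vertex \<open>w\<close> lies outside \<open>insert v S\<close>. If there is no such \<open>w\<close>, the complex is a simplex.

  For \<open>v \<notin> I\<close> compare the full subcomplexes on \<open>I\<close> and on \<open>insert v I\<close>. If \<open>S\<close> meets \<open>I\<close>, the
  second is the first with a cone glued on along a nonempty simplex, so restriction of reduced
  cohomology classes is an isomorphism. If \<open>S\<close> does not meet \<open>I\<close>, then \<open>v\<close> is an isolated point of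
  the second complex; restriction is still surjective in degrees \<open>p \<ge> 0\<close>, and injective except in
  degree \<open>0\<close>, where the kernel is generated by the indicator function of \<open>v\<close>. These are
  \<open>extend_cocycle\<close> and \<open>cobounding_from_base\<close>.

  Deleting \<open>v\<close> is one term of the differential \<open>d'\<close>, so \<open>d'\<close> is, for fixed \<open>p\<close>, a mapping cone
  over this restriction map. Where restriction is an isomorphism everything cancels, so all
  double cohomology comes from \<open>p = - 1\<close> and \<open>p = 0\<close>. For \<open>p = - 1\<close> the only nonzero group is
  the one of the empty set, which gives the copy of the integers in bidegree \<open>(0, 0)\<close>. For
  \<open>p = 0\<close> the kernel remains. It is spanned by the indicator functions of \<open>v\<close> on the sets
  \<open>insert v J\<close> with \<open>J\<close> a nonempty set of vertices outside \<open>insert v S\<close>, and \<open>d'\<close> acts on it as the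
  unaugmented simplicial boundary of the full simplex on these vertices. The latter is
  contractible, with cone point \<open>w\<close>, so only its degree zero homology survives: one copy of the
  integers, at sets \<open>{v, j}\<close>, that is in bidegree \<open>(-1, 4)\<close>.

  The surviving class is detected by \<open>edge_invariant\<close>. A degree zero class on a pair of vertices
  restricts to a cocycle on each of its two vertices which is a coboundary of a well-defined
  number, since the augmented cochains of a point are acyclic. Applying \<open>d'\<close> on cochains, taking
  these numbers, and applying \<open>d'\<close> once more produces an integer. It vanishes on every
  \<open>d'\<close>-boundary because \<open>d'\<close> squares to zero already on cochains.

  All of this takes place on representatives. A cochain is a total function on sets of vertices,
  so that restricting it to a subcomplex does not change it, and families of such functions, one
  for each set of vertices, carry \<open>d'\<close> as an honest function \<open>vertex_deletion\<close>. The passage to the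
  groups of cosets is made once, in \<open>trivial_double_cohomology\<close> and
  \<open>double_cohomology_iso_integer_group\<close>; the exactness that they need is \<open>double_complex_exact\<close>.
\<close>

section \<open>The simplicial coboundary operator, cones and contractions\<close>

lemma sum_antisymmetric_eq_0:
  fixes a :: "'b \<Rightarrow> 'b \<Rightarrow> int"
  assumes "finite t" and anti: "\<And>v w. v \<in> t \<Longrightarrow> w \<in> t \<Longrightarrow> v \<noteq> w \<Longrightarrow> a v w = - a w v"
  shows "(\<Sum>v\<in>t. \<Sum>w\<in>t - {v}. a v w) = 0"
proof -
  define b where "b v w = (if v = w then 0 else a v w)" for v w
  have "(\<Sum>v\<in>t. \<Sum>w\<in>t - {v}. a v w) = (\<Sum>v\<in>t. \<Sum>w\<in>t. b v w)"
  proof (rule sum.cong[OF refl])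
    fix v assume "v \<in> t"
    then have "(\<Sum>w\<in>t. b v w) = b v v + (\<Sum>w\<in>t - {v}. b v w)"
      using \<open>finite t\<close> by (simp add: sum.remove)
    also have "\<dots> = (\<Sum>w\<in>t - {v}. a v w)"
      unfolding b_def by (simp, intro sum.cong) auto
    finally show "(\<Sum>w\<in>t - {v}. a v w) = (\<Sum>w\<in>t. b v w)" ..
  qed
  also have "(\<Sum>v\<in>t. \<Sum>w\<in>t. b v w) = 0"
  proof -
    have "(\<Sum>v\<in>t. \<Sum>w\<in>t. b v w) = (\<Sum>w\<in>t. \<Sum>v\<in>t. b v w)"
      by (rule sum.swap)
    also have "\<dots> = (\<Sum>w\<in>t. \<Sum>v\<in>t. - b w v)"
      by (intro sum.cong refl) (auto simp: b_def intro: anti)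
    also have "\<dots> = - (\<Sum>v\<in>t. \<Sum>w\<in>t. b v w)"
      by (simp only: sum_negf)
    finally show ?thesis by linarith
  qed
  finally show ?thesis .
qed

lemma vertex_sign_square [simp]: "vertex_sign v t * vertex_sign v t = 1"
  by (simp add: vertex_sign_def flip: power_add mult_2)

lemma vertex_sign_square_left [simp]: "vertex_sign v t * (vertex_sign v t * x) = x"
  by (simp flip: mult.assoc)

lemma vertex_sign_singleton [simp]: "vertex_sign v {v} = 1"
proof -
  have "{r \<in> {v}. r < v} = {}" by auto
  then show ?thesis by (simp only: vertex_sign_def card.empty power_0)
qed

text \<open>The source of all cancellations: deleting two vertices in either order gives opposite signs.
  It makes both the simplicial coboundary and the double differential square to zero.\<close>

lemma vertex_sign_swap:
  assumes "finite t" "v \<in> t" "w \<in> t" "v \<noteq> w"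
  shows "vertex_sign w t * vertex_sign v (t - {w}) = - (vertex_sign v t * vertex_sign w (t - {v}))"
proof -
  have main: "vertex_sign y t * vertex_sign x (t - {y}) = - (vertex_sign x t * vertex_sign y (t - {x}))"
    if "x \<in> t" "y \<in> t" "x < y" for x y
  proof -
    have "{r \<in> t. r < y} = insert x {r \<in> t - {x}. r < y}"
      using that by auto
    then have "card {r \<in> t. r < y} = Suc (card {r \<in> t - {x}. r < y})"
      using \<open>finite t\<close> by simp
    then have 1: "vertex_sign y t = - vertex_sign y (t - {x})"
      by (simp add: vertex_sign_def)
    have "{r \<in> t - {y}. r < x} = {r \<in> t. r < x}"
      using that by auto
    then have "vertex_sign x (t - {y}) = vertex_sign x t"
      by (simp add: vertex_sign_def)
    with 1 show ?thesis by simp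
  qed
  show ?thesis
  proof (cases "v < w")
    case True
    then show ?thesis using main assms by blast
  next
    case False
    then have "w < v" using \<open>v \<noteq> w\<close> by simp
    from main[OF \<open>w \<in> t\<close> \<open>v \<in> t\<close> this] show ?thesis by simp
  qed
qed

text \<open>The simplicial coboundary without reference to a complex. Cochains are total functions, hence
  restriction to a subcomplex leaves them unchanged.\<close>

definition delta :: "('a::linorder set \<Rightarrow> int) \<Rightarrow> 'a set \<Rightarrow> int" where
  "delta f t = (\<Sum>v\<in>t. vertex_sign v t * f (t - {v}))"

lemma delta_add: "delta (\<lambda>s. f s + g s) t = delta f t + delta g t"
  by (simp add: delta_def distrib_left sum.distrib)

lemma delta_scale: "delta (\<lambda>s. c * f s) t = c * delta f t"
  by (simp add: delta_def sum_distrib_left mult.left_commute)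

lemma delta_sum: "delta (\<lambda>s. \<Sum>i\<in>A. f i s) t = (\<Sum>i\<in>A. delta (f i) t)"
  unfolding delta_def by (subst sum.swap) (simp add: sum_distrib_left)

lemma delta_diff: "delta (\<lambda>s. f s - g s) t = delta f t - delta g t"
  by (simp add: delta_def right_diff_distrib sum_subtractf)

lemma delta_zero [simp]: "delta (\<lambda>s. 0) t = 0"
  by (simp add: delta_def)

lemma delta_empty [simp]: "delta f {} = 0"
  by (simp add: delta_def)

lemma delta_singleton [simp]: "delta f {x} = f {}"
  by (simp add: delta_def)

lemma delta_cong:
  assumes "\<And>v. v \<in> t \<Longrightarrow> f (t - {v}) = g (t - {v})"
  shows "delta f t = delta g t"
  using assms by (simp add: delta_def)

lemma delta_delta:
  assumes "finite t"
  shows "delta (delta f) t = 0"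
proof -
  define a where "a v w = (vertex_sign v t * vertex_sign w (t - {v})) * f (t - {v, w})" for v w
  have "delta (delta f) t = (\<Sum>v\<in>t. \<Sum>w\<in>t - {v}. a v w)"
    unfolding delta_def a_def sum_distrib_left mult.assoc Diff_insert2[symmetric] ..
  also have "\<dots> = 0"
  proof (rule sum_antisymmetric_eq_0[OF assms])
    fix v w assume "v \<in> t" "w \<in> t" "v \<noteq> w"
    then show "a v w = - a w v"
      unfolding a_def vertex_sign_swap[OF assms \<open>w \<in> t\<close> \<open>v \<in> t\<close> \<open>v \<noteq> w\<close>[symmetric]]
      by (simp only: mult_minus_left insert_commute[of v])
  qed
  finally show ?thesis .
qed

text \<open>Up to sign, \<open>cone v\<close> moves a cochain on the link of \<open>v\<close> to the open star of \<open>v\<close>, and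
  \<open>contract w\<close> is the contracting homotopy of a simplex that joins faces to its vertex \<open>w\<close>.\<close>

definition cone :: "'a::linorder \<Rightarrow> ('a set \<Rightarrow> int) \<Rightarrow> 'a set \<Rightarrow> int" where
  "cone v g s = (if v \<in> s then vertex_sign v s * g (s - {v}) else 0)"

definition contract :: "'a::linorder \<Rightarrow> ('a set \<Rightarrow> int) \<Rightarrow> 'a set \<Rightarrow> int" where
  "contract w f s = (if w \<in> s then 0 else vertex_sign w (insert w s) * f (insert w s))"

lemma delta_cone:
  assumes "finite s"
  shows "delta (cone v g) s = - cone v (delta g) s"
proof (cases "v \<in> s")
  case True
  have "delta (cone v g) s = (\<Sum>w\<in>s - {v}. vertex_sign w s * cone v g (s - {w}))"
    using assms True by (simp add: delta_def sum.remove cone_def)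
  also have "\<dots> = (\<Sum>w\<in>s - {v}. - (vertex_sign v s * (vertex_sign w (s - {v}) * g (s - {v} - {w}))))"
  proof (rule sum.cong[OF refl])
    fix w assume w: "w \<in> s - {v}"
    then have v: "v \<in> s - {w}" "s - {w} - {v} = s - {v} - {w}"
      using True by auto
    have "vertex_sign w s * cone v g (s - {w}) =
        (vertex_sign w s * vertex_sign v (s - {w})) * g (s - {v} - {w})"
      using True w v by (simp add: cone_def)
    also have "vertex_sign w s * vertex_sign v (s - {w}) = - (vertex_sign v s * vertex_sign w (s - {v}))"
      using vertex_sign_swap[OF assms True, of w] w by auto
    finally show "vertex_sign w s * cone v g (s - {w}) =
        - (vertex_sign v s * (vertex_sign w (s - {v}) * g (s - {v} - {w})))"
      by simp
  qed
  also have "\<dots> = - cone v (delta g) s"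
    using True by (simp add: cone_def delta_def sum_distrib_left sum_negf)
  finally show ?thesis .
next
  case False
  then show ?thesis by (simp add: cone_def delta_def)
qed

text \<open>The homotopy formula. The identity holds pointwise without any complex in view, and it shows that
  a cocycle on a cone with apex \<open>w\<close> is a coboundary.\<close>

lemma delta_contract:
  assumes "finite s"
  shows "delta (contract w f) s + contract w (delta f) s = f s"
proof (cases "w \<in> s")
  case True
  have "delta (contract w f) s = vertex_sign w s * contract w f (s - {w})
      + (\<Sum>u\<in>s - {w}. vertex_sign u s * contract w f (s - {u}))"
    using assms True by (simp add: delta_def sum.remove)
  also have "(\<Sum>u\<in>s - {w}. vertex_sign u s * contract w f (s - {u})) = 0"
    using True by (intro sum.neutral) (simp add: contract_def)
  finally show ?thesis
    using True by (simp add: contract_def[of w f "s - {w}"] contract_def[of w "delta f" s] insert_absorb)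
next
  case False
  let ?t = "insert w s"
  have "delta f ?t = vertex_sign w ?t * f s + (\<Sum>u\<in>s. vertex_sign u ?t * f (?t - {u}))"
    using assms False by (simp add: delta_def)
  then have "contract w (delta f) s = f s + (\<Sum>u\<in>s. vertex_sign w ?t * (vertex_sign u ?t * f (?t - {u})))"
    using False by (simp add: contract_def distrib_left sum_distrib_left)
  moreover have "vertex_sign w ?t * (vertex_sign u ?t * f (?t - {u})) =
      - (vertex_sign u s * contract w f (s - {u}))" if "u \<in> s" for u
  proof -
    have u: "u \<noteq> w" "?t - {w} = s" "?t - {u} = insert w (s - {u})"
      using that False by auto
    have swap: "vertex_sign w ?t * vertex_sign u s = - (vertex_sign u ?t * vertex_sign w (?t - {u}))"
      using vertex_sign_swap[of ?t u w] assms that u by simp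
    have "vertex_sign w ?t * vertex_sign u ?t
        = (vertex_sign w ?t * vertex_sign u s) * (vertex_sign u s * vertex_sign u ?t)"
      by (simp only: mult.assoc vertex_sign_square_left)
    also have "\<dots> = - (vertex_sign u s * vertex_sign w (?t - {u}) * (vertex_sign u ?t * vertex_sign u ?t))"
      unfolding swap by (simp only: mult_minus_left ac_simps)
    finally have *: "vertex_sign w ?t * vertex_sign u ?t = - (vertex_sign u s * vertex_sign w (?t - {u}))"
      by simp
    have "contract w f (s - {u}) = vertex_sign w (?t - {u}) * f (?t - {u})"
      using False u by (simp add: contract_def)
    then show ?thesis
      by (simp only: mult.assoc[symmetric] *) (simp only: mult_minus_left mult.assoc)
  qed
  ultimately show ?thesis
    by (simp add: delta_def sum_negf)
qed


section \<open>Cocycles and coboundaries of a complex\<close>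

definition finite_complex :: "'a set set \<Rightarrow> bool" where
  "finite_complex K \<longleftrightarrow> (\<forall>s\<in>K. finite s \<and> (\<forall>t. t \<subseteq> s \<longrightarrow> t \<in> K))"

definition cocycle :: "int \<Rightarrow> 'a::linorder set set \<Rightarrow> ('a set \<Rightarrow> int) \<Rightarrow> bool" where
  "cocycle p K f \<longleftrightarrow> (\<forall>t\<in>simplices (p + 1) K. delta f t = 0)"

definition cobounding :: "int \<Rightarrow> 'a::linorder set set \<Rightarrow> ('a set \<Rightarrow> int) \<Rightarrow> bool" where
  "cobounding p K f \<longleftrightarrow> (\<exists>g. \<forall>s\<in>simplices p K. f s = delta g s)"

lemma simplices_face:
  assumes "finite_complex K" "t \<in> simplices (p + 1) K" "v \<in> t"
  shows "t - {v} \<in> simplices p K"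
proof -
  have "finite t" "t - {v} \<in> K" "int (card t) = p + 2"
    using assms by (auto simp: finite_complex_def simplices_def)
  moreover have "card t > 0" using assms(3) \<open>finite t\<close> card_gt_0_iff by blast
  ultimately show ?thesis
    using assms(3) by (simp add: simplices_def)
qed

lemma simplices_mono: "L \<subseteq> K \<Longrightarrow> simplices p L \<subseteq> simplices p K"
  by (auto simp: simplices_def)

lemma delta_cong_simplices:
  assumes "finite_complex K" "t \<in> simplices (p + 1) K" "\<And>s. s \<in> simplices p K \<Longrightarrow> f s = g s"
  shows "delta f t = delta g t"
  by (rule delta_cong) (blast intro: assms simplices_face)

lemma cocycle_mono: "cocycle p K f \<Longrightarrow> L \<subseteq> K \<Longrightarrow> cocycle p L f"
  using simplices_mono unfolding cocycle_def by blast

lemma cobounding_mono: "cobounding p K f \<Longrightarrow> L \<subseteq> K \<Longrightarrow> cobounding p L f"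
  using simplices_mono unfolding cobounding_def by blast

lemma cobounding_cong:
  "(\<And>s. s \<in> K \<Longrightarrow> f s = g s) \<Longrightarrow> cobounding p K f \<longleftrightarrow> cobounding p K g"
  by (simp add: cobounding_def simplices_def)

lemma cocycle_zero [simp]: "cocycle p K (\<lambda>s. 0)"
  by (simp add: cocycle_def)

lemma cocycle_add: "cocycle p K f \<Longrightarrow> cocycle p K g \<Longrightarrow> cocycle p K (\<lambda>s. f s + g s)"
  by (simp add: cocycle_def delta_add)

lemma cocycle_diff: "cocycle p K f \<Longrightarrow> cocycle p K g \<Longrightarrow> cocycle p K (\<lambda>s. f s - g s)"
  by (simp add: cocycle_def delta_diff)

lemma cocycle_scale: "cocycle p K f \<Longrightarrow> cocycle p K (\<lambda>s. c * f s)"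
  by (simp add: cocycle_def delta_scale)

lemma cocycle_sum: "(\<And>i. i \<in> A \<Longrightarrow> cocycle p K (f i)) \<Longrightarrow> cocycle p K (\<lambda>s. \<Sum>i\<in>A. f i s)"
  by (simp add: cocycle_def delta_sum)

lemma cobounding_zero [simp]: "cobounding p K (\<lambda>s. 0)"
  unfolding cobounding_def by (rule exI[of _ "\<lambda>s. 0"]) simp

lemma cobounding_scale:
  assumes "cobounding p K f"
  shows "cobounding p K (\<lambda>s. c * f s)"
proof -
  obtain g where "\<forall>s\<in>simplices p K. f s = delta g s"
    using assms unfolding cobounding_def by blast
  then show ?thesis
    unfolding cobounding_def by (intro exI[of _ "\<lambda>s. c * g s"]) (simp add: delta_scale)
qed

lemma cobounding_sum:
  "(\<And>i. i \<in> A \<Longrightarrow> cobounding p K (f i)) \<Longrightarrow> cobounding p K (\<lambda>s. \<Sum>i\<in>A. f i s)"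
proof -
  assume "\<And>i. i \<in> A \<Longrightarrow> cobounding p K (f i)"
  then obtain g where "\<And>i s. i \<in> A \<Longrightarrow> s \<in> simplices p K \<Longrightarrow> f i s = delta (g i) s"
    unfolding cobounding_def by metis
  then show ?thesis
    unfolding cobounding_def by (intro exI[of _ "\<lambda>s. \<Sum>i\<in>A. g i s"]) (simp add: delta_sum)
qed

lemma cobounding_diff:
  assumes "cobounding p K f" "cobounding p K g"
  shows "cobounding p K (\<lambda>s. f s - g s)"
proof -
  obtain f' g' where "\<forall>s\<in>simplices p K. f s = delta f' s" "\<forall>s\<in>simplices p K. g s = delta g' s"
    using assms unfolding cobounding_def by blast
  then show ?thesis
    unfolding cobounding_def by (intro exI[of _ "\<lambda>s. f' s - g' s"]) (simp add: delta_diff)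
qed

text \<open>Since the complex is augmented, a degree zero cochain cobounds if and only if it is constant on
  vertices.\<close>

lemma cobounding_0_iff:
  "cobounding 0 K f \<longleftrightarrow> (\<forall>x y. {x} \<in> K \<longrightarrow> {y} \<in> K \<longrightarrow> f {x} = f {y})"
proof
  assume "cobounding 0 K f"
  then obtain g where "\<And>s. s \<in> simplices 0 K \<Longrightarrow> f s = delta g s"
    unfolding cobounding_def by blast
  then have "f {x} = g {}" if "{x} \<in> K" for x
    using that by (simp add: simplices_def)
  then show "\<forall>x y. {x} \<in> K \<longrightarrow> {y} \<in> K \<longrightarrow> f {x} = f {y}" by simp
next
  assume const: "\<forall>x y. {x} \<in> K \<longrightarrow> {y} \<in> K \<longrightarrow> f {x} = f {y}"
  define c where "c = f {SOME x. {x} \<in> K}"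
  have "f {x} = c" if "{x} \<in> K" for x
    unfolding c_def using const someI[of "\<lambda>x. {x} \<in> K", OF that] that by blast
  then have "\<forall>s\<in>simplices 0 K. f s = delta (\<lambda>_. c) s"
    by (auto simp: simplices_def card_1_singleton_iff)
  then show "cobounding 0 K f"
    unfolding cobounding_def by blast
qed

text \<open>The augmentation of a nonempty complex is injective: the coboundary of \<open>f\<close> at the vertex \<open>x\<close> is
  the value of \<open>f\<close> at the empty simplex.\<close>

lemma cobounding_minus_1:
  assumes "finite_complex K" "cocycle (- 1) K f" "{x} \<in> K"
  shows "cobounding (- 1) K f"
proof -
  have "f {} = 0"
    using assms(2,3) by (auto simp: cocycle_def simplices_def dest: bspec[of _ _ "{x}"])
  moreover have "simplices (- 1) K \<subseteq> {{}}"
    using assms(1) by (auto simp: simplices_def finite_complex_def)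
  ultimately show ?thesis
    unfolding cobounding_def by (intro exI[of _ "\<lambda>_. 0"]) auto
qed

lemma full_subcomplex_mono: "J \<subseteq> I \<Longrightarrow> full_subcomplex K J \<subseteq> full_subcomplex K I"
  by (auto simp: full_subcomplex_def)


section \<open>The double differential on families of cochains\<close>

text \<open>The double differential on representatives, without the overall sign \<open>(-1)\<^sup>p\<^sup>+\<^sup>1\<close>, which
  depends on \<open>p\<close> only.\<close>

definition vertex_deletion ::
  "'a::linorder set \<Rightarrow> ('a set \<Rightarrow> 'a set \<Rightarrow> int) \<Rightarrow> 'a set \<Rightarrow> 'a set \<Rightarrow> int" where
  "vertex_deletion V F J s = (\<Sum>i\<in>V - J. vertex_sign i (insert i J) * F (insert i J) s)"

definition cocycle_family ::
  "'a::linorder set \<Rightarrow> 'a set set \<Rightarrow> int \<Rightarrow> int \<Rightarrow> ('a set \<Rightarrow> 'a set \<Rightarrow> int) \<Rightarrow> bool" where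
  "cocycle_family V K p l F \<longleftrightarrow> (\<forall>I\<in>vertex_subsets V l. cocycle p (full_subcomplex K I) (F I))"

definition cobounding_family ::
  "'a::linorder set \<Rightarrow> 'a set set \<Rightarrow> int \<Rightarrow> int \<Rightarrow> ('a set \<Rightarrow> 'a set \<Rightarrow> int) \<Rightarrow> bool" where
  "cobounding_family V K p l F \<longleftrightarrow> (\<forall>I\<in>vertex_subsets V l. cobounding p (full_subcomplex K I) (F I))"

lemma vertex_subsets_insert:
  assumes "finite V" "J \<in> vertex_subsets V l" "i \<in> V - J"
  shows "insert i J \<in> vertex_subsets V (l + 1)"
  using assms finite_subset[of J V] by (auto simp: vertex_subsets_def)

lemma vertex_subsets_remove:
  assumes "finite V" "I \<in> vertex_subsets V l" "i \<in> I"
  shows "I - {i} \<in> vertex_subsets V (l - 1)"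
proof -
  have "finite I" using assms by (auto simp: vertex_subsets_def intro: finite_subset)
  then have "card I > 0" using assms(3) card_gt_0_iff by blast
  then show ?thesis
    using assms \<open>finite I\<close> by (auto simp: vertex_subsets_def)
qed

lemma vertex_deletion_diff:
  "vertex_deletion V (\<lambda>I s. F I s - G I s) J s = vertex_deletion V F J s - vertex_deletion V G J s"
  by (simp add: vertex_deletion_def right_diff_distrib sum_subtractf)

lemma vertex_deletion_add:
  "vertex_deletion V (\<lambda>I s. F I s + G I s) J s = vertex_deletion V F J s + vertex_deletion V G J s"
  by (simp add: vertex_deletion_def distrib_left sum.distrib)

lemma vertex_deletion_scale:
  "vertex_deletion V (\<lambda>I s. c * F I s) J s = c * vertex_deletion V F J s"
  by (simp add: vertex_deletion_def sum_distrib_left mult.left_commute)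

lemma vertex_deletion_split:
  assumes "finite V" "i \<in> V - J"
  shows "vertex_deletion V F J s = vertex_sign i (insert i J) * F (insert i J) s +
    (\<Sum>k\<in>V - J - {i}. vertex_sign k (insert k J) * F (insert k J) s)"
  unfolding vertex_deletion_def using assms by (simp add: sum.remove)

text \<open>This holds for arbitrary families of functions, before passing to cohomology, since restriction
  of total functions is the identity. The vanishing of \<open>edge_invariant\<close> on boundaries rests on this.\<close>

lemma vertex_deletion_vertex_deletion:
  assumes "finite V" "J \<subseteq> V"
  shows "vertex_deletion V (vertex_deletion V F) J s = 0"
proof -
  define a where "a i j = (vertex_sign i (insert i J) * vertex_sign j (insert i (insert j J))) *
    F (insert i (insert j J)) s" for i j
  have "vertex_deletion V (vertex_deletion V F) J s = (\<Sum>i\<in>V - J. \<Sum>j\<in>V - J - {i}. a i j)"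
    unfolding vertex_deletion_def a_def sum_distrib_left
    by (intro sum.cong refl) (auto simp: insert_commute)
  also have "\<dots> = 0"
  proof (rule sum_antisymmetric_eq_0)
    fix i j assume ij: "i \<in> V - J" "j \<in> V - J" "i \<noteq> j"
    let ?t = "insert i (insert j J)"
    have t: "?t - {i} = insert j J" "?t - {j} = insert i J" "insert j (insert i J) = ?t"
      using ij by auto
    have "finite J" using assms finite_subset by blast
    then have "vertex_sign i (?t - {j}) * vertex_sign j ?t = - (vertex_sign j (?t - {i}) * vertex_sign i ?t)"
      using vertex_sign_swap[of ?t i j] ij(3) by (simp add: mult.commute)
    then show "a i j = - a j i"
      unfolding a_def t by simp
  qed (use assms in simp)
  finally show ?thesis .
qed

lemma cocycle_vertex_deletion:
  assumes "\<And>i. i \<in> V - J \<Longrightarrow> cocycle p (full_subcomplex K J) (F (insert i J))"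
  shows "cocycle p (full_subcomplex K J) (vertex_deletion V F J)"
  unfolding vertex_deletion_def[abs_def]
  by (intro cocycle_sum cocycle_scale assms)

lemma cocycle_family_vertex_deletion:
  assumes "finite V" "cocycle_family V K p l F"
  shows "cocycle_family V K p (l - 1) (vertex_deletion V F)"
  unfolding cocycle_family_def
proof
  fix J assume J: "J \<in> vertex_subsets V (l - 1)"
  show "cocycle p (full_subcomplex K J) (vertex_deletion V F J)"
  proof (rule cocycle_vertex_deletion)
    fix i assume "i \<in> V - J"
    then have "insert i J \<in> vertex_subsets V l"
      using vertex_subsets_insert[OF assms(1) J] by simp
    then show "cocycle p (full_subcomplex K J) (F (insert i J))"
      using assms(2) cocycle_mono full_subcomplex_mono[of J "insert i J"]
      unfolding cocycle_family_def by blast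
  qed
qed

text \<open>On a single point \<open>j\<close> every degree zero cochain is the coboundary of its value at \<open>{j}\<close>, viewed as
  a cochain of degree \<open>- 1\<close>. The invariant deletes a vertex from all pairs, lifts the results in this
  way, and deletes the remaining vertex; the sign of the last deletion is \<open>1\<close>.\<close>

definition edge_invariant :: "'a::linorder set \<Rightarrow> ('a set \<Rightarrow> 'a set \<Rightarrow> int) \<Rightarrow> int" where
  "edge_invariant V F = (\<Sum>j\<in>V. vertex_deletion V F {j} {j})"

lemma edge_invariant_add:
  "edge_invariant V (\<lambda>I s. F I s + G I s) = edge_invariant V F + edge_invariant V G"
  by (simp add: edge_invariant_def vertex_deletion_add sum.distrib)

lemma edge_invariant_diff:
  "edge_invariant V (\<lambda>I s. F I s - G I s) = edge_invariant V F - edge_invariant V G"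
  by (simp add: edge_invariant_def vertex_deletion_diff sum_subtractf)

lemma edge_invariant_vertex_deletion:
  "finite V \<Longrightarrow> edge_invariant V (vertex_deletion V G) = 0"
  unfolding edge_invariant_def by (intro sum.neutral) (simp add: vertex_deletion_vertex_deletion)

text \<open>The two deletions of a pair \<open>{i, j}\<close> carry opposite signs, so a cochain with equal values at \<open>i\<close>
  and \<open>j\<close> contributes nothing.\<close>

lemma edge_invariant_cobounding_family:
  assumes "simplicial_complex_on V K" "cobounding_family V K 0 2 F"
  shows "edge_invariant V F = 0"
proof -
  have fin: "finite V" using assms(1) by (simp add: simplicial_complex_on_def)
  have "edge_invariant V F = (\<Sum>j\<in>V. \<Sum>i\<in>V - {j}. vertex_sign i {i, j} * F {i, j} {j})"
    by (simp add: edge_invariant_def vertex_deletion_def)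
  also have "\<dots> = 0"
  proof (rule sum_antisymmetric_eq_0[OF fin])
    fix i j assume ij: "i \<in> V" "j \<in> V" "i \<noteq> j"
    have "{i, j} \<in> vertex_subsets V 2"
      using ij by (simp add: vertex_subsets_def)
    then have "F {i, j} {i} = F {i, j} {j}"
      using assms ij unfolding cobounding_family_def cobounding_0_iff
      by (auto simp: simplicial_complex_on_def full_subcomplex_def)
    moreover have "vertex_sign i {i, j} = - vertex_sign j {i, j}"
      using vertex_sign_swap[of "{i, j}" j i] ij(3) by (auto simp: insert_Diff_if)
    ultimately show "vertex_sign j {j, i} * F {j, i} {i} = - (vertex_sign i {i, j} * F {i, j} {j})"
      by (simp add: insert_commute)
  qed
  finally show ?thesis .
qed

lemma edge_invariant_single:
  assumes "finite V" "v \<in> V" "w \<in> V" "v \<noteq> w"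
  shows "edge_invariant V (\<lambda>I s. if I = {v, w} then f s else 0) =
    vertex_sign w {v, w} * (f {v} - f {w})"
proof -
  let ?F = "\<lambda>I s. if I = {v, w} then f s else (0::int)"
  have v: "vertex_deletion V ?F {v} {v} = vertex_sign w {v, w} * f {v}"
    using assms by (subst vertex_deletion_split[where i = w])
      (auto simp: insert_commute doubleton_eq_iff intro!: sum.neutral)
  have w: "vertex_deletion V ?F {w} {w} = vertex_sign v {v, w} * f {w}"
    using assms by (subst vertex_deletion_split[where i = v])
      (auto simp: insert_commute doubleton_eq_iff intro!: sum.neutral)
  have other: "vertex_deletion V ?F {j} {j} = 0" if "j \<in> V - {v} - {w}" for j
    unfolding vertex_deletion_def using that by (intro sum.neutral) (auto simp: doubleton_eq_iff)
  have "edge_invariant V ?F = vertex_deletion V ?F {v} {v} + (vertex_deletion V ?F {w} {w} +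
      (\<Sum>j\<in>V - {v} - {w}. vertex_deletion V ?F {j} {j}))"
    using assms by (simp add: edge_invariant_def sum.remove[of V v] sum.remove[of "V - {v}" w])
  also have "\<dots> = vertex_sign w {v, w} * f {v} + vertex_sign v {v, w} * f {w}"
    by (simp add: v w other)
  also have "vertex_sign v {v, w} = - vertex_sign w {v, w}"
    using vertex_sign_swap[of "{v, w}" w v] assms(4) by (auto simp: insert_Diff_if)
  finally show ?thesis by (simp add: right_diff_distrib)
qed


section \<open>Adding a vertex whose star is a simplex\<close>

locale double_complex =
  fixes V :: "'a::linorder set" and K
  assumes complex: "simplicial_complex_on V K"
begin

lemma finite_V: "finite V"
  using complex by (simp add: simplicial_complex_on_def)

lemma finite_complex_full [simp]: "finite_complex (full_subcomplex K I)"
  using complex unfolding simplicial_complex_on_def finite_complex_def full_subcomplex_def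
  by (auto intro: finite_subset)

lemma singleton_in_full: "x \<in> I \<Longrightarrow> I \<subseteq> V \<Longrightarrow> {x} \<in> full_subcomplex K I"
  using complex by (auto simp: simplicial_complex_on_def full_subcomplex_def)

end

text \<open>The closed star of \<open>v\<close> is the simplex \<open>insert v S\<close>. For the glued complex, \<open>v\<close> is a vertex of the
  new simplex outside the gluing face.\<close>

locale simplicial_star = double_complex V K for V :: "'a::linorder set" and K +
  fixes v S
  assumes apex: "v \<notin> S" and star: "insert v S \<in> K"
    and star_max: "\<And>s. s \<in> K \<Longrightarrow> v \<in> s \<Longrightarrow> s \<subseteq> insert v S"
begin

abbreviation KI :: "'a set \<Rightarrow> 'a set set" where "KI \<equiv> full_subcomplex K"

lemma finite_simplex: "s \<in> simplices q (KI I) \<Longrightarrow> finite s"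
  using finite_complex_full[of I] by (auto simp: simplices_def finite_complex_def)

lemma v_in_V: "v \<in> V"
  using complex star by (auto simp: simplicial_complex_on_def)

lemma face_in_K: "s \<subseteq> insert v S \<Longrightarrow> s \<in> K"
  using complex star unfolding simplicial_complex_on_def by blast

text \<open>Surjectivity of restriction. A cocycle is a coboundary on the link simplex as soon as the link is
  nonempty, and a primitive there gives the values to be put on the simplices containing \<open>v\<close>. If the
  link is empty, any value at the isolated point \<open>v\<close> will do, but for \<open>p = - 1\<close> the cocycle condition
  at \<open>{v}\<close> is a genuine obstruction.\<close>

lemma extend_cocycle:
  assumes "v \<notin> I" "cocycle p (KI I) f" "p \<ge> 0 \<or> S \<inter> I \<noteq> {}"
  shows "\<exists>f'. cocycle p (KI (insert v I)) f' \<and> (\<forall>s\<in>KI I. f' s = f s)"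
proof (cases "S \<inter> I = {}")
  case True
  define f' where "f' s = (if v \<in> s then 0 else f s)" for s
  have "delta f' t = 0" if t: "t \<in> simplices (p + 1) (KI (insert v I))" for t
  proof (cases "v \<in> t")
    case True
    have "t \<subseteq> {v}"
      using star_max[of t] t True \<open>S \<inter> I = {}\<close> by (auto simp: simplices_def full_subcomplex_def)
    then have "card t \<le> 1" using card_mono[of "{v}" t] by simp
    then show ?thesis using t assms(3) \<open>S \<inter> I = {}\<close> by (simp add: simplices_def)
  next
    case False
    then have "t \<in> simplices (p + 1) (KI I)"
      using t by (auto simp: simplices_def full_subcomplex_def)
    moreover have "delta f' t = delta f t"
      by (rule delta_cong) (use False in \<open>simp add: f'_def\<close>)
    ultimately show ?thesis using assms(2) by (simp add: cocycle_def)
  qed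
  moreover have "\<forall>s\<in>KI I. f' s = f s"
    using assms(1) by (auto simp: full_subcomplex_def f'_def)
  ultimately show ?thesis unfolding cocycle_def by blast
next
  case False
  then obtain w where w: "w \<in> S" "w \<in> I" by blast
  define f0 where "f0 s = (if v \<in> s then 0 else f s)" for s
  \<comment> \<open>On faces of \<open>S \<inter> I\<close> the cochain \<open>contract w f\<close> is a primitive of \<open>f\<close>. By \<open>delta_cone\<close>, its cone
    contributes its negative coboundary at simplices containing \<open>v\<close>, which cancels the term that \<open>f0\<close>
    contributes through the face opposite to \<open>v\<close>.\<close>
  define f' where "f' s = f0 s + cone v (contract w f) s" for s
  have "delta f' t = 0" if t: "t \<in> simplices (p + 1) (KI (insert v I))" for t
  proof -
    have fin: "finite t"
      using t by (rule finite_simplex)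
    have split: "delta f' t = delta f0 t - cone v (delta (contract w f)) t"
      unfolding f'_def by (simp only: delta_add delta_cone[OF fin])
    show ?thesis
    proof (cases "v \<in> t")
      case True
      let ?r = "t - {v}"
      have r: "?r \<subseteq> S \<inter> I" "int (card ?r) = p + 1"
        using t True star_max[of t] simplices_face[OF finite_complex_full t True]
        by (auto simp: simplices_def full_subcomplex_def)
      have "delta f0 t = vertex_sign v t * f ?r"
        using fin True by (auto simp: delta_def f0_def sum.remove intro!: sum.neutral split: if_splits)
      moreover have "contract w (delta f) ?r = 0"
      proof (cases "w \<in> ?r")
        case False
        then have "insert w ?r \<in> simplices (p + 1) (KI I)"
          using r w fin face_in_K[of "insert w ?r"] by (auto simp: simplices_def full_subcomplex_def)
        then show ?thesis using assms(2) by (simp add: contract_def cocycle_def)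
      qed (simp add: contract_def)
      then have "delta (contract w f) ?r = f ?r"
        using delta_contract[of ?r w f] fin by simp
      ultimately show ?thesis
        using True by (simp add: split cone_def)
    next
      case False
      then have "t \<in> simplices (p + 1) (KI I)"
        using t by (auto simp: simplices_def full_subcomplex_def)
      moreover have "delta f0 t = delta f t"
        by (rule delta_cong) (use False in \<open>simp add: f0_def\<close>)
      ultimately show ?thesis
        using assms(2) False by (simp add: cocycle_def split cone_def)
    qed
  qed
  moreover have "\<forall>s\<in>KI I. f' s = f s"
    using assms(1) by (auto simp: full_subcomplex_def f'_def f0_def cone_def)
  ultimately show ?thesis unfolding cocycle_def by blast
qed

text \<open>Injectivity of restriction. After subtracting a coboundary, \<open>f\<close> vanishes off the star of \<open>v\<close>, so
  it comes from a cocycle one degree lower on the link, where it is a coboundary because the link is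
  a nonempty simplex. If the link is empty, the only new simplex is \<open>{v}\<close>, of dimension zero.\<close>

lemma cobounding_from_base:
  assumes "v \<notin> I" "cocycle p (KI (insert v I)) f" "cobounding p (KI I) f" "p \<noteq> 0 \<or> S \<inter> I \<noteq> {}"
  shows "cobounding p (KI (insert v I)) f"
proof -
  obtain g where g: "\<And>s. s \<in> simplices p (KI I) \<Longrightarrow> f s = delta g s"
    using assms(3) unfolding cobounding_def by blast
  have base: "s \<in> simplices p (KI I)" if "s \<in> simplices p (KI (insert v I))" "v \<notin> s" for s
    using that by (auto simp: simplices_def full_subcomplex_def)
  show ?thesis
  proof (cases "S \<inter> I = {}")
    case True
    have "v \<notin> s" if s: "s \<in> simplices p (KI (insert v I))" for s
    proof
      assume "v \<in> s"
      then have "s = {v}"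
        using star_max[of s] s True by (auto simp: simplices_def full_subcomplex_def)
      then show False using s assms(4) True by (simp add: simplices_def)
    qed
    then show ?thesis
      using g base unfolding cobounding_def by blast
  next
    case False
    then obtain w where w: "w \<in> S" "w \<in> I" by blast
    define g1 where "g1 s = (if v \<in> s then 0 else g s)" for s
    define h where "h s = f s - delta g1 s" for s
    \<comment> \<open>\<open>contract v h\<close> is the cochain on the link from which \<open>h\<close> comes, \<open>contract w\<close> takes a primitive of
      it there, and the cone carries this back to the star.\<close>
    define k where "k s = - cone v (contract w (contract v h)) s" for s
    have fin: "finite s" if "s \<in> simplices q (KI (insert v I))" for s q
      using that by (rule finite_simplex)
    have h_base: "h s = 0" if s: "s \<in> simplices p (KI I)" for s
    proof -
      have "v \<notin> s" using s assms(1) by (auto simp: simplices_def full_subcomplex_def)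
      then have "delta g1 s = delta g s" by (intro delta_cong) (simp add: g1_def)
      then show ?thesis by (simp add: h_def g[OF s])
    qed
    have h_cocycle: "delta h s = 0" if s: "s \<in> simplices (p + 1) (KI (insert v I))" for s
      using assms(2) s unfolding h_def
      by (simp add: delta_diff delta_delta[OF fin[OF s]] cocycle_def)
    have "h s = delta k s" if s: "s \<in> simplices p (KI (insert v I))" for s
    proof -
      have dk: "delta k s = cone v (delta (contract w (contract v h))) s"
        using delta_scale[of "-1" "cone v (contract w (contract v h))" s] delta_cone[OF fin[OF s]]
        by (simp add: k_def[abs_def])
      show ?thesis
      proof (cases "v \<in> s")
        case True
        let ?r = "s - {v}"
        have r: "?r \<subseteq> S \<inter> I" "int (card ?r) = p"
          using s True star_max[of s] simplices_face[OF finite_complex_full[of "insert v I"], of s "p - 1" v]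
          by (auto simp: simplices_def full_subcomplex_def)
        have "contract w (delta (contract v h)) ?r = 0"
        proof (cases "w \<in> ?r")
          case False
          let ?q = "insert w ?r"
          have q: "?q \<subseteq> S \<inter> I" "int (card ?q) = p + 1" "v \<notin> ?q" "finite ?q"
            using r w False fin[OF s] apex by auto
          then have "h ?q = 0"
            using face_in_K[of ?q] by (intro h_base) (auto simp: simplices_def full_subcomplex_def)
          moreover have "delta h (insert v ?q) = 0"
            using face_in_K[of "insert v ?q"] q
            by (intro h_cocycle) (auto simp: simplices_def full_subcomplex_def)
          then have "contract v (delta h) ?q = 0"
            by (simp add: contract_def)
          ultimately have "delta (contract v h) ?q = 0"
            using delta_contract[OF q(4), of v h] by simp
          then show ?thesis by (simp add: contract_def)
        qed (simp add: contract_def)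
        then have "delta (contract w (contract v h)) ?r = contract v h ?r"
          using delta_contract[of ?r w "contract v h"] fin[OF s] by simp
        then show ?thesis
          using True by (simp add: dk cone_def) (simp add: contract_def insert_absorb)
      next
        case False
        then show ?thesis using h_base[OF base[OF s]] by (simp add: dk cone_def)
      qed
    qed
    then have "\<forall>s\<in>simplices p (KI (insert v I)). f s = delta (\<lambda>s. g1 s + k s) s"
      by (simp add: delta_add h_def diff_eq_eq)
    then show ?thesis unfolding cobounding_def by blast
  qed
qed

end


section \<open>Exactness of the double complex\<close>

context simplicial_star
begin

text \<open>The component at \<open>I - {i}\<close> of a double cycle is a signed sum over the sets that arise from it by
  adding a vertex. If all other terms cobound there, so does the one for \<open>I\<close>.\<close>

lemma cobounding_of_remaining_term:
  assumes bd: "cobounding_family V K p (l - 1) (vertex_deletion V Z)"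
    and I: "I \<in> vertex_subsets V l" "i \<in> I"
    and others: "\<And>k. k \<in> V - I \<Longrightarrow> cobounding p (KI (I - {i})) (Z (insert k (I - {i})))"
  shows "cobounding p (KI (I - {i})) (Z I)"
proof -
  let ?J = "I - {i}"
  have iV: "i \<in> V - ?J" "insert i ?J = I" using I by (auto simp: vertex_subsets_def)
  have "cobounding p (KI ?J) (vertex_deletion V Z ?J)"
    using bd vertex_subsets_remove[OF finite_V I] by (simp add: cobounding_family_def)
  moreover have "cobounding p (KI ?J)
      (\<lambda>s. \<Sum>k\<in>V - ?J - {i}. vertex_sign k (insert k ?J) * Z (insert k ?J) s)"
    by (intro cobounding_sum cobounding_scale others) auto
  ultimately have "cobounding p (KI ?J) (\<lambda>s. vertex_deletion V Z ?J s -
      (\<Sum>k\<in>V - ?J - {i}. vertex_sign k (insert k ?J) * Z (insert k ?J) s))"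
    by (rule cobounding_diff)
  then have "cobounding p (KI ?J) (\<lambda>s. vertex_sign i I * Z I s)"
    by (simp add: vertex_deletion_split[OF finite_V iV(1)] insert_absorb[OF I(2)])
  from cobounding_scale[OF this, of "vertex_sign i I"] show ?thesis by simp
qed

text \<open>Extending cocycles over \<open>v\<close> is a right inverse of the term of the differential that deletes \<open>v\<close>.
  Sets without \<open>v\<close> get the zero cochain, so no other term contributes at a set avoiding \<open>v\<close>.\<close>

lemma clear_sets_avoiding_apex:
  assumes "p \<ge> 0" and cyc: "cocycle_family V K p l F"
  obtains G where "cocycle_family V K p (l + 1) G"
    and "\<And>J s. J \<in> vertex_subsets V l \<Longrightarrow> v \<notin> J \<Longrightarrow> s \<in> KI J \<Longrightarrow> vertex_deletion V G J s = F J s"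
proof -
  have "\<exists>f'. cocycle p (KI (insert v J)) f' \<and> (\<forall>s\<in>KI J. f' s = F J s)"
    if "J \<in> vertex_subsets V l" "v \<notin> J" for J
    using extend_cocycle[OF that(2), of p "F J"] cyc that(1) \<open>p \<ge> 0\<close> by (auto simp: cocycle_family_def)
  then obtain E where E: "\<And>J. J \<in> vertex_subsets V l \<Longrightarrow> v \<notin> J \<Longrightarrow> cocycle p (KI (insert v J)) (E J)"
      "\<And>J s. J \<in> vertex_subsets V l \<Longrightarrow> v \<notin> J \<Longrightarrow> s \<in> KI J \<Longrightarrow> E J s = F J s"
    by metis
  define G where "G I s = (if v \<in> I then vertex_sign v I * E (I - {v}) s else 0)" for I s
  show thesis
  proof
    show "cocycle_family V K p (l + 1) G"
      unfolding cocycle_family_def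
    proof
      fix I assume I: "I \<in> vertex_subsets V (l + 1)"
      show "cocycle p (KI I) (G I)"
      proof (cases "v \<in> I")
        case True
        then have "cocycle p (KI I) (E (I - {v}))"
          using E(1)[of "I - {v}"] vertex_subsets_remove[OF finite_V I] by (simp add: insert_absorb)
        then show ?thesis
          using True by (simp add: G_def[abs_def] cocycle_scale)
      qed (simp add: G_def[abs_def])
    qed
  next
    fix J s assume J: "J \<in> vertex_subsets V l" "v \<notin> J" and s: "s \<in> KI J"
    have "vertex_deletion V G J s = vertex_sign v (insert v J) * G (insert v J) s +
        (\<Sum>k\<in>V - J - {v}. vertex_sign k (insert k J) * G (insert k J) s)"
      using J v_in_V finite_V by (intro vertex_deletion_split) auto
    also have "(\<Sum>k\<in>V - J - {v}. vertex_sign k (insert k J) * G (insert k J) s) = 0"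
      using J by (intro sum.neutral) (auto simp: G_def)
    finally show "vertex_deletion V G J s = F J s"
      using J s E(2) by (simp add: G_def[of "insert v J"])
  qed
qed

text \<open>Once a double cycle cobounds on all sets avoiding \<open>v\<close>, the cycle condition puts the other
  components into the kernel of the restriction that deletes \<open>v\<close>.\<close>

lemma cobounding_above_base:
  assumes cyc: "cocycle_family V K p l Z" and bd: "cobounding_family V K p (l - 1) (vertex_deletion V Z)"
    and base: "\<And>I. I \<in> vertex_subsets V l \<Longrightarrow> v \<notin> I \<Longrightarrow> cobounding p (KI I) (Z I)"
    and I: "I \<in> vertex_subsets V l" "v \<in> I"
  shows "cobounding p (KI (I - {v})) (Z I)"
    and "p \<noteq> 0 \<or> S \<inter> I \<noteq> {} \<Longrightarrow> cobounding p (KI I) (Z I)"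
proof -
  show *: "cobounding p (KI (I - {v})) (Z I)"
  proof (rule cobounding_of_remaining_term[OF bd I])
    fix k assume k: "k \<in> V - I"
    let ?J = "insert k (I - {v})"
    have "?J \<in> vertex_subsets V l"
      using vertex_subsets_insert[OF finite_V vertex_subsets_remove[OF finite_V I], of k] k by simp
    then have "cobounding p (KI ?J) (Z ?J)"
      using base[of ?J] k I(2) by auto
    then show "cobounding p (KI (I - {v})) (Z ?J)"
      by (rule cobounding_mono) (simp add: full_subcomplex_mono subset_insertI)
  qed
  assume "p \<noteq> 0 \<or> S \<inter> I \<noteq> {}"
  then have "p \<noteq> 0 \<or> S \<inter> (I - {v}) \<noteq> {}" using apex by auto
  then show "cobounding p (KI I) (Z I)"
    using cobounding_from_base[of "I - {v}" p "Z I"] * cyc I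
    by (simp add: insert_absorb cocycle_family_def)
qed

definition apex_indicator :: "'a set \<Rightarrow> int" where
  "apex_indicator s = (if s = {v} then 1 else 0)"

text \<open>The generator of the kernel of restriction in degree zero: without neighbours in \<open>I\<close>, the vertex
  \<open>v\<close> is a connected component.\<close>

lemma cocycle_apex_indicator:
  assumes "S \<inter> I = {}"
  shows "cocycle 0 (KI I) apex_indicator"
  unfolding cocycle_def
proof
  fix t assume t: "t \<in> simplices (0 + 1) (KI I)"
  then have "t \<noteq> {v}" "card t = 2" by (auto simp: simplices_def)
  have "v \<notin> t"
  proof
    assume "v \<in> t"
    then have "t \<subseteq> {v}"
      using star_max[of t] t assms by (auto simp: simplices_def full_subcomplex_def)
    then show False using \<open>v \<in> t\<close> \<open>t \<noteq> {v}\<close> by auto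
  qed
  then have "delta apex_indicator t = delta (\<lambda>s. 0) t"
    by (intro delta_cong) (auto simp: apex_indicator_def)
  then show "delta apex_indicator t = 0" by simp
qed

text \<open>The contraction of the simplex on the vertices outside \<open>insert v S\<close> towards \<open>w\<close>. The
  component of \<open>Z\<close> at \<open>insert v J\<close> cobounds if \<open>J\<close> meets \<open>S\<close>; otherwise it is, modulo
  coboundaries, a multiple of the indicator function of \<open>v\<close>, and placing this multiple at \<open>insert w (insert v J)\<close> clears all components at sets that do not contain
  both \<open>v\<close> and \<open>w\<close>.\<close>

lemma clear_isolated_apex:
  assumes w: "w \<in> V" "w \<notin> insert v S"
    and cyc: "cocycle_family V K 0 l Z" and bd: "cobounding_family V K 0 (l - 1) (vertex_deletion V Z)"
    and base: "\<And>I. I \<in> vertex_subsets V l \<Longrightarrow> v \<notin> I \<Longrightarrow> cobounding 0 (KI I) (Z I)"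
  obtains G where "cocycle_family V K 0 (l + 1) G"
    and "\<And>I. I \<in> vertex_subsets V l \<Longrightarrow> \<not> {v, w} \<subseteq> I \<Longrightarrow>
          cobounding 0 (KI I) (\<lambda>s. Z I s - vertex_deletion V G I s)"
proof -
  \<comment> \<open>The coefficient of the indicator function of \<open>v\<close>. The restriction of the component to
    \<open>J\<close> cobounds, hence is constant there, and the choice of a point in \<open>J\<close> is immaterial. For empty \<open>J\<close> the value is arbitrary,
    but then the indicator function is itself constant on the only vertex.\<close>
  define a where "a J = Z (insert v J) {v} - Z (insert v J) {SOME x. x \<in> J}" for J
  define G where "G I s = (if {v, w} \<subseteq> I \<and> S \<inter> I = {}
    then vertex_sign w I * a (I - {v, w}) * apex_indicator s else 0)" for I s
  show thesis
  proof
    show "cocycle_family V K 0 (l + 1) G"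
      unfolding cocycle_family_def
    proof
      fix I
      show "cocycle 0 (KI I) (G I)"
      proof (cases "{v, w} \<subseteq> I \<and> S \<inter> I = {}")
        case True
        then show ?thesis
          by (auto simp: G_def[abs_def] intro!: cocycle_scale cocycle_apex_indicator)
      next
        case False
        then show ?thesis
          by (simp only: G_def[abs_def] if_False cocycle_zero)
      qed
    qed
  next
    fix I assume I: "I \<in> vertex_subsets V l" and not_vw: "\<not> {v, w} \<subseteq> I"
    then have IV: "I \<subseteq> V" by (simp add: vertex_subsets_def)
    show "cobounding 0 (KI I) (\<lambda>s. Z I s - vertex_deletion V G I s)"
    proof (cases "v \<in> I")
      case False
      have "vertex_deletion V G I s = 0" if "s \<in> KI I" for s
      proof -
        have "s \<noteq> {v}" using that False by (auto simp: full_subcomplex_def)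
        then show ?thesis
          unfolding vertex_deletion_def by (intro sum.neutral) (simp add: G_def apex_indicator_def)
      qed
      then show ?thesis
        using cobounding_cong[of "KI I" "\<lambda>s. Z I s - vertex_deletion V G I s" "Z I"]
          base[OF I False] by simp
    next
      case True
      then have wI: "w \<notin> I" using not_vw by simp
      have above: "cobounding 0 (KI (I - {v})) (Z I)" "S \<inter> I \<noteq> {} \<Longrightarrow> cobounding 0 (KI I) (Z I)"
        using cobounding_above_base[OF cyc bd base I True] by auto
      show ?thesis
      proof (cases "S \<inter> I = {}")
        case False
        have "vertex_deletion V G I s = 0" for s
          unfolding vertex_deletion_def using False by (intro sum.neutral) (auto simp: G_def)
        then show ?thesis using above(2)[OF False] by simp
      next
        case SI: True
        have "vertex_deletion V G I s = a (I - {v}) * apex_indicator s" for s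
        proof -
          have "vertex_deletion V G I s = vertex_sign w (insert w I) * G (insert w I) s +
              (\<Sum>k\<in>V - I - {w}. vertex_sign k (insert k I) * G (insert k I) s)"
            using w wI finite_V by (intro vertex_deletion_split) auto
          also have "(\<Sum>k\<in>V - I - {w}. vertex_sign k (insert k I) * G (insert k I) s) = 0"
            using wI by (intro sum.neutral) (auto simp: G_def)
          moreover have "insert w I - {v, w} = I - {v}" using wI by auto
          ultimately show ?thesis
            using True SI w by (simp add: G_def mult.assoc)
        qed
        moreover have "Z I {x} - a (I - {v}) * apex_indicator {x} =
            Z I {y} - a (I - {v}) * apex_indicator {y}" if xy: "x \<in> I" "y \<in> I" for x y
        proof (cases "I - {v} = {}")
          case False
          define b where "b = (SOME x. x \<in> I - {v})"
          have b: "b \<in> I - {v}"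
            unfolding b_def using someI_ex[of "\<lambda>x. x \<in> I - {v}"] False by blast
          have ab: "a (I - {v}) = Z I {v} - Z I {b}"
            using True by (simp add: a_def b_def insert_absorb)
          have "Z I {z} = Z I {b}" if "z \<in> I" "z \<noteq> v" for z
            using above(1) that b IV unfolding cobounding_0_iff by (blast intro: singleton_in_full)
          then have "Z I {z} - a (I - {v}) * apex_indicator {z} = Z I {b}" if "z \<in> I" for z
            using that by (cases "z = v") (auto simp: ab apex_indicator_def)
          then show ?thesis using xy by simp
        next
          case True
          then have "x = y" using xy by blast
          then show ?thesis by simp
        qed
        ultimately show ?thesis
          unfolding cobounding_0_iff by (simp add: full_subcomplex_def)
      qed
    qed
  qed
qed

text \<open>In negative degrees the components cobound to begin with, apart from the empty set in degree
  \<open>- 1\<close>. In the other degrees they are cleared in three stages: at sets avoiding \<open>v\<close>, then, in degree zero, at sets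
  avoiding \<open>w\<close>, and last at sets containing both. In the last stage the cycle condition at \<open>I - {v}\<close>
  and \<open>I - {w}\<close> shows that the component at \<open>I\<close> is constant on each of these sets. They overlap
  unless \<open>I = {v, w}\<close>, which is why bidegree \<open>(-1, 4)\<close> is special: there the condition is replaced
  by the vanishing of the edge invariant.\<close>

lemma double_complex_exact:
  assumes w: "w \<in> V" "w \<notin> insert v S"
    and cyc: "cocycle_family V K p l F" and bd: "cobounding_family V K p (l - 1) (vertex_deletion V F)"
    and deg: "(p, l) \<noteq> (- 1, 0)" "(p, l) = (0, 2) \<Longrightarrow> edge_invariant V F = 0"
  shows "\<exists>G. cocycle_family V K p (l + 1) G \<and>
    cobounding_family V K p l (\<lambda>I s. F I s - vertex_deletion V G I s)"
proof (cases "p \<ge> 0")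
  case False
  have "cobounding p (KI I) (F I)" if I: "I \<in> vertex_subsets V l" for I
  proof (cases "p = - 1")
    case True
    then have "I \<noteq> {}" "I \<subseteq> V" using I deg by (auto simp: vertex_subsets_def)
    then obtain x where "{x} \<in> KI I" using singleton_in_full by blast
    then show ?thesis
      using cobounding_minus_1[OF finite_complex_full, of I "F I"] cyc I True
      by (simp add: cocycle_family_def)
  next
    case False
    then have "simplices p (KI I) = {}" using \<open>\<not> p \<ge> 0\<close> by (auto simp: simplices_def)
    then show ?thesis by (simp add: cobounding_def)
  qed
  then show ?thesis
    by (intro exI[of _ "\<lambda>I s. 0"]) (simp add: cocycle_family_def cobounding_family_def vertex_deletion_def)
next
  case True
  obtain G where G: "cocycle_family V K p (l + 1) G"
    and G_base: "\<And>J s. J \<in> vertex_subsets V l \<Longrightarrow> v \<notin> J \<Longrightarrow> s \<in> KI J \<Longrightarrow> vertex_deletion V G J s = F J s"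
    using clear_sets_avoiding_apex[OF True cyc] by blast
  define Z where "Z I s = F I s - vertex_deletion V G I s" for I s
  have Z_cyc: "cocycle_family V K p l Z"
    using cyc cocycle_family_vertex_deletion[OF finite_V G]
    by (simp add: cocycle_family_def Z_def[abs_def] cocycle_diff)
  have Z_bd: "cobounding_family V K p (l - 1) (vertex_deletion V Z)"
    unfolding cobounding_family_def
  proof
    fix J assume J: "J \<in> vertex_subsets V (l - 1)"
    then have "vertex_deletion V Z J = vertex_deletion V F J"
      by (intro ext) (simp add: Z_def[abs_def] vertex_deletion_diff vertex_deletion_vertex_deletion
          finite_V vertex_subsets_def)
    then show "cobounding p (KI J) (vertex_deletion V Z J)"
      using bd J by (simp add: cobounding_family_def)
  qed
  have Z_base: "cobounding p (KI I) (Z I)" if "I \<in> vertex_subsets V l" "v \<notin> I" for I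
    using cobounding_cong[of "KI I" "Z I" "\<lambda>s. 0" p] G_base[OF that] by (simp add: Z_def)
  show ?thesis
  proof (cases "p = 0")
    case False
    have "cobounding_family V K p l Z"
      unfolding cobounding_family_def
      using Z_base cobounding_above_base(2)[OF Z_cyc Z_bd Z_base] False by blast
    then show ?thesis using G unfolding Z_def[abs_def] by blast
  next
    case p: True
    obtain G' where G': "cocycle_family V K 0 (l + 1) G'"
      and off: "\<And>I. I \<in> vertex_subsets V l \<Longrightarrow> \<not> {v, w} \<subseteq> I \<Longrightarrow>
          cobounding 0 (KI I) (\<lambda>s. Z I s - vertex_deletion V G' I s)"
      using clear_isolated_apex[OF w Z_cyc[unfolded p] Z_bd[unfolded p] Z_base[unfolded p]] by blast
    define H where "H I s = G I s + G' I s" for I s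
    define Y where "Y I s = Z I s - vertex_deletion V G' I s" for I s
    have Y_eq: "Y I s = F I s - vertex_deletion V H I s" for I s
      by (simp add: Y_def Z_def H_def[abs_def] vertex_deletion_add)
    have H: "cocycle_family V K 0 (l + 1) H"
      using G[unfolded p] G' by (simp add: cocycle_family_def H_def[abs_def] cocycle_add)
    have Y_cyc: "cocycle_family V K 0 l Y"
      using Z_cyc[unfolded p] cocycle_family_vertex_deletion[OF finite_V G']
      by (simp add: cocycle_family_def Y_def[abs_def] cocycle_diff)
    have Y_bd: "cobounding_family V K 0 (l - 1) (vertex_deletion V Y)"
      unfolding cobounding_family_def
    proof
      fix J assume J: "J \<in> vertex_subsets V (l - 1)"
      then have "vertex_deletion V Y J = vertex_deletion V Z J"
        by (intro ext) (simp add: Y_def[abs_def] vertex_deletion_diff vertex_deletion_vertex_deletion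
            finite_V vertex_subsets_def)
      then show "cobounding 0 (KI J) (vertex_deletion V Y J)"
        using Z_bd[unfolded p] J by (simp add: cobounding_family_def)
    qed
    have Y_off: "cobounding 0 (KI I) (Y I)" if "I \<in> vertex_subsets V l" "\<not> {v, w} \<subseteq> I" for I
      using off[OF that] by (simp add: Y_def[abs_def])
    have Y_pair: "cobounding 0 (KI I) (Y I)" if I: "I \<in> vertex_subsets V l" and vw: "{v, w} \<subseteq> I" for I
    proof (cases "l = 2")
      case False
      have IV: "I \<subseteq> V" "finite I" "int (card I) = l"
        using I finite_V by (auto simp: vertex_subsets_def intro: finite_subset)
      have 1: "cobounding 0 (KI (I - {v})) (Y I)"
        by (rule cobounding_above_base(1)[OF Y_cyc Y_bd _ I]) (use Y_off vw in auto)
      have 2: "cobounding 0 (KI (I - {w})) (Y I)"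
      proof (rule cobounding_of_remaining_term[OF Y_bd I])
        fix k assume k: "k \<in> V - I"
        let ?J = "insert k (I - {w})"
        have "?J \<in> vertex_subsets V l"
          using vertex_subsets_insert[OF finite_V vertex_subsets_remove[OF finite_V I, of w], of k] k vw
          by simp
        then have "cobounding 0 (KI ?J) (Y ?J)"
          using Y_off[of ?J] k vw by auto
        then show "cobounding 0 (KI (I - {w})) (Y ?J)"
          by (rule cobounding_mono) (simp add: full_subcomplex_mono subset_insertI)
      qed (use Y_off vw in auto)
      have "I \<noteq> {v, w}" using IV False w by auto
      then obtain u where u: "u \<in> I" "u \<noteq> v" "u \<noteq> w" using vw by blast
      have "Y I {x} = Y I {u}" if "x \<in> I" for x
      proof (cases "x = v")
        case True
        then show ?thesis
          using 2 that u w IV unfolding cobounding_0_iff by (blast intro: singleton_in_full)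
      next
        case False
        then show ?thesis
          using 1 that u IV unfolding cobounding_0_iff by (blast intro: singleton_in_full)
      qed
      then show ?thesis
        unfolding cobounding_0_iff by (simp add: full_subcomplex_def)
    next
      case l: True
      have "card I = card {v, w}" "finite I"
        using I l w finite_V by (auto simp: vertex_subsets_def intro: finite_subset)
      then have I_eq: "I = {v, w}"
        using vw card_subset_eq by metis
      \<comment> \<open>Split off the component at \<open>{v, w}\<close>. All others cobound, so the edge invariant of \<open>Y\<close>, which is
        zero, is up to sign the difference of the values of this component at \<open>v\<close> and \<open>w\<close>.\<close>
      define P where "P J s = (if J = {v, w} then Y {v, w} s else 0)" for J s
      have "cobounding_family V K 0 2 (\<lambda>J s. Y J s - P J s)"
        unfolding cobounding_family_def
      proof
        fix J assume J: "J \<in> vertex_subsets V 2"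
        show "cobounding 0 (KI J) (\<lambda>s. Y J s - P J s)"
        proof (cases "J = {v, w}")
          case False
          have "card J = card {v, w}" "finite J"
            using J w finite_V by (auto simp: vertex_subsets_def intro: finite_subset)
          then have "\<not> {v, w} \<subseteq> J"
            using False card_subset_eq by metis
          then show ?thesis using Y_off J l False by (simp add: P_def)
        qed (simp add: P_def)
      qed
      then have "edge_invariant V (\<lambda>J s. Y J s - P J s) = 0"
        by (rule edge_invariant_cobounding_family[OF complex])
      moreover have "edge_invariant V Y = 0"
        using deg(2) p l by (simp add: Y_eq[abs_def] edge_invariant_diff edge_invariant_vertex_deletion finite_V)
      ultimately have "edge_invariant V P = 0"
        by (simp add: edge_invariant_diff)
      then have "vertex_sign w {v, w} * (Y {v, w} {v} - Y {v, w} {w}) = 0"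
        using edge_invariant_single[OF finite_V v_in_V w(1), of "Y {v, w}"] w by (auto simp: P_def[abs_def])
      then have "Y {v, w} {v} = Y {v, w} {w}"
        by (simp add: vertex_sign_def)
      then show ?thesis
        unfolding I_eq cobounding_0_iff by (auto simp: full_subcomplex_def)
    qed
    have "cobounding_family V K 0 l Y"
      using Y_off Y_pair unfolding cobounding_family_def by blast
    then show ?thesis
      using H unfolding p Y_eq[abs_def] by blast
  qed
qed

lemma edge_invariant_realizes_1:
  assumes w: "w \<in> V" "w \<notin> insert v S"
  obtains F where "cocycle_family V K 0 2 F" "edge_invariant V F = 1"
proof
  define F where "F I s = (if I = {v, w} then vertex_sign w {v, w} * apex_indicator s else 0)" for I s
  show "cocycle_family V K 0 2 F"
    unfolding cocycle_family_def
  proof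
    fix I
    show "cocycle 0 (KI I) (F I)"
      using apex w by (cases "I = {v, w}")
        (auto simp: F_def[abs_def] intro!: cocycle_scale cocycle_apex_indicator)
  qed
  show "edge_invariant V F = 1"
    using edge_invariant_single[OF finite_V v_in_V w(1), of "\<lambda>s. vertex_sign w {v, w} * apex_indicator s"] w
    by (auto simp: F_def[abs_def] apex_indicator_def)
qed

text \<open>Reduced cohomology of a point vanishes, so every family of cocycles on pairs is a double cycle.\<close>

lemma cobounding_family_singletons: "cobounding_family V K 0 1 F"
  unfolding cobounding_family_def cobounding_0_iff
  by (auto simp: vertex_subsets_def full_subcomplex_def card_1_singleton_iff)

end


section \<open>Cochain representatives of reduced cohomology classes\<close>

text \<open>The facts about \<open>middle_cohomology\<close> that are used twice: for the cochains of one complex, and for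
  the moment-angle cohomology with its double differential.\<close>

locale three_term_complex =
  fixes A :: "('a, 'm) monoid_scheme" and f and B :: "('b, 'n) monoid_scheme"
    and g and C :: "('c, 'k) monoid_scheme"
  assumes group_A: "group A" and comm_B: "comm_group B" and group_C: "group C"
    and f_hom: "f \<in> hom A B" and g_hom: "g \<in> hom B C"
    and composite: "\<And>a. a \<in> carrier A \<Longrightarrow> g (f a) = \<one>\<^bsub>C\<^esub>"
begin

abbreviation M where "M \<equiv> middle_cohomology A f B g C"
abbreviation Im where "Im \<equiv> f ` carrier A"
abbreviation Ker where "Ker \<equiv> kernel B C g"
abbreviation ZB where "ZB \<equiv> subgroup_generated B Ker"

sublocale B: comm_group B by (rule comm_B)
sublocale F: group_hom A B f
  using group_A f_hom by (simp add: group_hom_def group_hom_axioms_def B.is_group)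
sublocale G: group_hom B C g
  using group_C g_hom by (simp add: group_hom_def group_hom_axioms_def B.is_group)

lemma carrier_ZB [simp]: "carrier ZB = Ker"
  by (rule subgroup.carrier_subgroup_generated_subgroup[OF G.subgroup_kernel])

lemma Im_sub_Ker: "Im \<subseteq> Ker"
  using composite F.hom_closed by (auto simp: kernel_def)

lemma subgroup_Im: "subgroup Im ZB" "subgroup Im B"
  using B.subgroup_of_subgroup_generated[OF Im_sub_Ker F.img_is_subgroup] F.img_is_subgroup .

sublocale ZB: comm_group ZB
  by (rule B.abelian_subgroup_generated[OF comm_B])

lemma r_coset_ZB: "H #>\<^bsub>ZB\<^esub> b = H #>\<^bsub>B\<^esub> b"
  by (simp add: r_coset_def)

lemma M_eq: "M = ZB Mod Im"
  by (simp add: middle_cohomology_def)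

lemma comm_group_M: "comm_group M"
  unfolding M_eq by (rule ZB.abelian_FactGroup[OF subgroup_Im(1)])

lemma one_M: "\<one>\<^bsub>M\<^esub> = Im"
  by (simp add: M_eq)

lemma carrier_M: "carrier M = (\<lambda>b. Im #>\<^bsub>B\<^esub> b) ` Ker"
  by (simp add: M_eq carrier_FactGroup r_coset_ZB)

lemma mult_M:
  assumes "b \<in> Ker" "b' \<in> Ker"
  shows "(Im #>\<^bsub>B\<^esub> b) \<otimes>\<^bsub>M\<^esub> (Im #>\<^bsub>B\<^esub> b') = Im #>\<^bsub>B\<^esub> (b \<otimes>\<^bsub>B\<^esub> b')"
proof -
  have "Im \<lhd> ZB" using subgroup_Im(1) by (simp add: ZB.normal_iff_subgroup)
  from normal.rcos_sum[OF this, of b b'] assms show ?thesis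
    by (simp add: M_eq r_coset_ZB)
qed

lemma r_coset_eq_iff:
  assumes "b \<in> carrier B" "b' \<in> carrier B"
  shows "Im #>\<^bsub>B\<^esub> b = Im #>\<^bsub>B\<^esub> b' \<longleftrightarrow> b \<otimes>\<^bsub>B\<^esub> inv\<^bsub>B\<^esub> b' \<in> Im"
proof -
  have sub: "Im \<subseteq> carrier B" using subgroup_Im(2) by (rule subgroup.subset)
  have closed: "b \<otimes>\<^bsub>B\<^esub> inv\<^bsub>B\<^esub> b' \<in> carrier B" using assms by (intro B.m_closed B.inv_closed)
  show ?thesis
  proof
    assume "Im #>\<^bsub>B\<^esub> b = Im #>\<^bsub>B\<^esub> b'"
    from B.coset_mult_inv2[OF this assms sub] show "b \<otimes>\<^bsub>B\<^esub> inv\<^bsub>B\<^esub> b' \<in> Im"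
      by (rule B.coset_join1[OF _ closed subgroup_Im(2)])
  next
    assume "b \<otimes>\<^bsub>B\<^esub> inv\<^bsub>B\<^esub> b' \<in> Im"
    from B.coset_join2[OF closed subgroup_Im(2) this] show "Im #>\<^bsub>B\<^esub> b = Im #>\<^bsub>B\<^esub> b'"
      by (rule B.coset_mult_inv1[OF _ assms sub])
  qed
qed

lemma trivial_group_M:
  assumes "\<And>b. b \<in> carrier B \<Longrightarrow> g b = \<one>\<^bsub>C\<^esub> \<Longrightarrow> b \<in> Im"
  shows "trivial_group M"
proof -
  interpret M: comm_group M by (rule comm_group_M)
  have "Im #>\<^bsub>B\<^esub> b = Im" if "b \<in> Ker" for b
    using that assms B.coset_join2[OF _ subgroup_Im(2), of b] by (simp add: kernel_def)
  then show ?thesis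
    by (auto simp: M.trivial_group_subset carrier_M one_M)
qed

text \<open>The first isomorphism theorem, for a homomorphism that is defined on all of \<open>B\<close> rather than on
  cycles only.\<close>

lemma iso_M:
  assumes "group Q" and h: "h \<in> hom B Q" and vanish: "\<And>a. a \<in> carrier A \<Longrightarrow> h (f a) = \<one>\<^bsub>Q\<^esub>"
    and inj: "\<And>b. b \<in> carrier B \<Longrightarrow> g b = \<one>\<^bsub>C\<^esub> \<Longrightarrow> h b = \<one>\<^bsub>Q\<^esub> \<Longrightarrow> b \<in> Im"
    and surj: "h ` Ker = carrier Q"
  shows "M \<cong> Q"
proof -
  interpret H: group_hom ZB Q h
    using \<open>group Q\<close> B.hom_from_subgroup_generated[OF h]
    by (simp add: group_hom_def group_hom_axioms_def ZB.is_group)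
  have "kernel ZB Q h = Im"
    using Im_sub_Ker vanish inj unfolding kernel_def[of ZB] carrier_ZB by (auto simp: kernel_def)
  then show ?thesis
    using H.FactGroup_iso surj by (simp add: M_eq)
qed

end

lemma group_cochain_group [simp]: "group (cochain_group p K)"
  by (simp add: cochain_group_def)

lemma comm_group_cochain_group: "comm_group (cochain_group p K)"
  by (rule group.group_comm_groupI[OF group_cochain_group]) (auto simp: cochain_group_def add.commute)

lemma carrier_cochain_group: "carrier (cochain_group p K) = (\<lambda>f. restrict f (simplices p K)) ` UNIV"
proof -
  have "f \<in> (\<lambda>f. restrict f (simplices p K)) ` UNIV" if "f \<in> extensional (simplices p K)" for f :: "_ \<Rightarrow> int"
    using extensional_restrict[OF that] by (metis rangeI)
  then show ?thesis
    by (auto simp: cochain_group_def PiE_def)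
qed

lemma mult_cochain_group:
  "restrict f (simplices p K) \<otimes>\<^bsub>cochain_group p K\<^esub> restrict g (simplices p K) =
    restrict (\<lambda>s. f s + g s) (simplices p K)"
  by (auto simp: cochain_group_def)

lemma one_cochain_group: "\<one>\<^bsub>cochain_group p K\<^esub> = restrict (\<lambda>s. 0) (simplices p K)"
  by (simp add: cochain_group_def)

lemma inv_cochain_group:
  "inv\<^bsub>cochain_group p K\<^esub> (restrict f (simplices p K)) = restrict (\<lambda>s. - f s) (simplices p K)"
  by (simp add: cochain_group_def) (auto simp: restrict_def)

lemma coboundary_restrict:
  assumes "finite_complex K"
  shows "coboundary p K (restrict f (simplices p K)) = restrict (delta f) (simplices (p + 1) K)"
proof -
  have "coboundary p K (restrict f (simplices p K)) =
      restrict (delta (restrict f (simplices p K))) (simplices (p + 1) K)"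
    by (simp only: coboundary_def delta_def[abs_def])
  then show ?thesis
    by (auto simp: restrict_def intro!: ext delta_cong_simplices[OF assms])
qed

lemma restrict_eq_iff: "restrict f A = restrict g A \<longleftrightarrow> (\<forall>x\<in>A. f x = g x)"
  by (metis restrict_apply' restrict_ext)

lemma coboundary_image:
  assumes "finite_complex K"
  shows "restrict f (simplices p K) \<in> coboundary (p - 1) K ` carrier (cochain_group (p - 1) K) \<longleftrightarrow>
    cobounding p K f"
  using coboundary_restrict[OF assms, of "p - 1"]
  by (auto simp: carrier_cochain_group image_image image_iff cobounding_def restrict_eq_iff)

lemma three_term_complex_cochains:
  assumes "finite_complex K"
  shows "three_term_complex (cochain_group (p - 1) K) (coboundary (p - 1) K)
    (cochain_group p K) (coboundary p K) (cochain_group (p + 1) K)"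
proof (rule three_term_complex.intro)
  have hom: "coboundary q K \<in> hom (cochain_group q K) (cochain_group (q + 1) K)" for q
    by (rule homI)
      (auto simp: carrier_cochain_group mult_cochain_group coboundary_restrict[OF assms]
        delta_add restrict_eq_iff)
  from hom[of "p - 1"] show "coboundary (p - 1) K \<in> hom (cochain_group (p - 1) K) (cochain_group p K)"
    by simp
  show "coboundary p K \<in> hom (cochain_group p K) (cochain_group (p + 1) K)" by (rule hom)
  fix a assume "a \<in> carrier (cochain_group (p - 1) K)"
  then obtain f where a: "a = restrict f (simplices (p - 1) K)"
    by (auto simp: carrier_cochain_group)
  have "coboundary p K (coboundary (p - 1) K a) = restrict (delta (delta f)) (simplices (p + 1) K)"
    using coboundary_restrict[OF assms, of "p - 1" f] coboundary_restrict[OF assms, of p "delta f"]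
    by (simp add: a)
  also have "\<dots> = \<one>\<^bsub>cochain_group (p + 1) K\<^esub>"
    using assms by (auto simp: one_cochain_group restrict_eq_iff delta_delta simplices_def finite_complex_def)
  finally show "coboundary p K (coboundary (p - 1) K a) = \<one>\<^bsub>cochain_group (p + 1) K\<^esub>" .
qed (auto simp: comm_group_cochain_group)

text \<open>The coset of the restriction of a total function to the simplices of dimension \<open>p\<close>.\<close>

definition cohomology_class :: "int \<Rightarrow> 'a::linorder set set \<Rightarrow> ('a set \<Rightarrow> int) \<Rightarrow> ('a set \<Rightarrow> int) set" where
  "cohomology_class p K f =
    (coboundary (p - 1) K ` carrier (cochain_group (p - 1) K)) #>\<^bsub>cochain_group p K\<^esub>
      restrict f (simplices p K)"

context
  fixes K :: "'a::linorder set set" and p :: int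
  assumes finite_complex: "finite_complex K"
begin

interpretation C: three_term_complex "cochain_group (p - 1) K" "coboundary (p - 1) K"
    "cochain_group p K" "coboundary p K" "cochain_group (p + 1) K"
  by (rule three_term_complex_cochains[OF finite_complex])

lemma restrict_in_Ker: "restrict f (simplices p K) \<in> C.Ker \<longleftrightarrow> cocycle p K f"
  by (auto simp: kernel_def carrier_cochain_group coboundary_restrict[OF finite_complex]
      one_cochain_group restrict_eq_iff cocycle_def)

lemma comm_group_reduced_cohomology: "comm_group (reduced_cohomology p K)"
  unfolding reduced_cohomology_def by (rule C.comm_group_M)

lemma carrier_reduced_cohomology:
  "carrier (reduced_cohomology p K) = cohomology_class p K ` {f. cocycle p K f}"
proof -
  have "C.Ker = (\<lambda>f. restrict f (simplices p K)) ` {f. cocycle p K f}"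
    using restrict_in_Ker by (auto simp: kernel_def carrier_cochain_group)
  then show ?thesis
    unfolding reduced_cohomology_def C.carrier_M cohomology_class_def[abs_def] by (simp add: image_image)
qed

lemma mult_cohomology_class:
  assumes "cocycle p K f" "cocycle p K g"
  shows "cohomology_class p K f \<otimes>\<^bsub>reduced_cohomology p K\<^esub> cohomology_class p K g =
    cohomology_class p K (\<lambda>s. f s + g s)"
  using C.mult_M[of "restrict f (simplices p K)" "restrict g (simplices p K)"] assms
  unfolding reduced_cohomology_def cohomology_class_def by (simp only: restrict_in_Ker mult_cochain_group)

lemma cohomology_class_eq_iff:
  "cohomology_class p K f = cohomology_class p K g \<longleftrightarrow> cobounding p K (\<lambda>s. f s - g s)"
proof -
  have closed: "restrict h (simplices p K) \<in> carrier (cochain_group p K)" for h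
    by (simp add: carrier_cochain_group)
  show ?thesis
    unfolding cohomology_class_def C.r_coset_eq_iff[OF closed closed] inv_cochain_group
      mult_cochain_group coboundary_image[OF finite_complex] by simp
qed

lemma one_reduced_cohomology: "\<one>\<^bsub>reduced_cohomology p K\<^esub> = cohomology_class p K (\<lambda>s. 0)"
proof -
  have "cohomology_class p K (\<lambda>s. 0) = C.Im"
    unfolding cohomology_class_def one_cochain_group[symmetric]
    by (rule C.B.coset_mult_one[OF subgroup.subset[OF C.subgroup_Im(2)]])
  then show ?thesis by (simp add: reduced_cohomology_def C.one_M)
qed

lemma cohomology_class_closed:
  "cocycle p K f \<Longrightarrow> cohomology_class p K f \<in> carrier (reduced_cohomology p K)"
  by (simp add: carrier_reduced_cohomology)

text \<open>Multiples of a cocycle form a homomorphism from the integers, and homomorphisms preserve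
  powers.\<close>

lemma int_pow_cohomology_class:
  assumes "cocycle p K f"
  shows "cohomology_class p K f [^]\<^bsub>reduced_cohomology p K\<^esub> (n::int) =
    cohomology_class p K (\<lambda>s. n * f s)"
proof -
  have "(\<lambda>n. cohomology_class p K (\<lambda>s. n * f s)) \<in> hom integer_group (reduced_cohomology p K)"
    using assms
    by (intro homI) (simp_all add: cohomology_class_closed cocycle_scale mult_cohomology_class distrib_right)
  from hom_int_pow[OF this, of 1 n] comm_group.axioms(2)[OF comm_group_reduced_cohomology]
  show ?thesis by simp
qed

lemma finprod_cohomology_class:
  assumes "finite A" "\<And>i. i \<in> A \<Longrightarrow> cocycle p K (f i)"
  shows "finprod (reduced_cohomology p K) (\<lambda>i. cohomology_class p K (f i)) A =
    cohomology_class p K (\<lambda>s. \<Sum>i\<in>A. f i s)"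
  using assms
proof (induction A rule: finite_induct)
  case empty
  interpret R: comm_group "reduced_cohomology p K" by (rule comm_group_reduced_cohomology)
  show ?case by (simp add: one_reduced_cohomology)
next
  case (insert i A)
  interpret R: comm_group "reduced_cohomology p K" by (rule comm_group_reduced_cohomology)
  show ?case
    using insert by (subst R.finprod_insert)
      (auto simp: cohomology_class_closed mult_cohomology_class cocycle_sum)
qed

lemma mem_cohomology_class:
  "f' \<in> cohomology_class p K f \<longleftrightarrow>
    (\<exists>g. f' = restrict g (simplices p K) \<and> cobounding p K (\<lambda>s. g s - f s))"
proof
  assume "f' \<in> cohomology_class p K f"
  then obtain h where h: "f' = restrict (delta h) (simplices p K) \<otimes>\<^bsub>cochain_group p K\<^esub> restrict f (simplices p K)"
    using coboundary_restrict[OF finite_complex, of "p - 1"]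
    by (auto simp: cohomology_class_def r_coset_def carrier_cochain_group)
  then have "f' = restrict (\<lambda>s. delta h s + f s) (simplices p K)"
    by (simp add: mult_cochain_group)
  moreover have "cobounding p K (\<lambda>s. (delta h s + f s) - f s)"
    by (auto simp: cobounding_def)
  ultimately show "\<exists>g. f' = restrict g (simplices p K) \<and> cobounding p K (\<lambda>s. g s - f s)" by blast
next
  assume "\<exists>g. f' = restrict g (simplices p K) \<and> cobounding p K (\<lambda>s. g s - f s)"
  then obtain g where g: "f' = restrict g (simplices p K)" "cobounding p K (\<lambda>s. g s - f s)" by blast
  have "f' \<in> cohomology_class p K g"
    unfolding g(1) cohomology_class_def
    by (rule C.B.rcos_self[OF _ C.subgroup_Im(2)]) (simp add: carrier_cochain_group)
  then show "f' \<in> cohomology_class p K f"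
    using g(2) cohomology_class_eq_iff by blast
qed

end

lemma induced_restriction_cohomology_class:
  assumes "finite_complex K" "L \<subseteq> K" "finite_complex L"
  shows "induced_restriction p L (cohomology_class p K f) = cohomology_class p L f"
proof -
  have "(coboundary (p - 1) L ` carrier (cochain_group (p - 1) L)) #>\<^bsub>cochain_group p L\<^esub>
      restrict f' (simplices p L) = cohomology_class p L f" if f': "f' \<in> cohomology_class p K f" for f'
  proof -
    obtain g where g: "f' = restrict g (simplices p K)" "cobounding p K (\<lambda>s. g s - f s)"
      using f' unfolding mem_cohomology_class[OF assms(1)] by blast
    have "restrict f' (simplices p L) = restrict g (simplices p L)"
      using simplices_mono[OF assms(2)] by (simp add: g(1) Int_absorb1)
    moreover have "cohomology_class p L g = cohomology_class p L f"
      using cobounding_mono[OF g(2) assms(2)] by (simp add: cohomology_class_eq_iff[OF assms(3)])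
    ultimately show ?thesis by (simp add: cohomology_class_def)
  qed
  moreover have "cohomology_class p K f \<noteq> {}"
    using mem_cohomology_class[OF assms(1), of "restrict f (simplices p K)" p f] by force
  ultimately show ?thesis
    by (simp add: induced_restriction_def)
qed


section \<open>Double cohomology in terms of families of cochains\<close>

definition family_class ::
  "'a::linorder set \<Rightarrow> 'a set set \<Rightarrow> int \<Rightarrow> int \<Rightarrow> ('a set \<Rightarrow> 'a set \<Rightarrow> int) \<Rightarrow>
   'a set \<Rightarrow> ('a set \<Rightarrow> int) set" where
  "family_class V K p l F = (\<lambda>I\<in>vertex_subsets V l. cohomology_class p (full_subcomplex K I) (F I))"

context double_complex
begin

lemma finite_vertex_subsets: "finite (vertex_subsets V l)"
  using finite_V by (simp add: vertex_subsets_def)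

lemma group_reduced_cohomology_full: "group (reduced_cohomology p (full_subcomplex K I))"
  by (rule comm_group.axioms(2)[OF comm_group_reduced_cohomology[OF finite_complex_full]])

context
  fixes p k l :: int
  assumes p: "l - k - 1 = p"
begin

lemma carrier_moment_angle_cohomology:
  "carrier (moment_angle_cohomology V K k l) = family_class V K p l ` {F. cocycle_family V K p l F}"
proof -
  have "carrier (moment_angle_cohomology V K k l) =
      (\<Pi>\<^sub>E I\<in>vertex_subsets V l. carrier (reduced_cohomology p (full_subcomplex K I)))"
    unfolding moment_angle_cohomology_def p
    by (subst carrier_sum_group) (auto simp: group_reduced_cohomology_full finite_vertex_subsets)
  also have "\<dots> = family_class V K p l ` {F. cocycle_family V K p l F}"
  proof (intro equalityI subsetI)
    fix x assume x: "x \<in> (\<Pi>\<^sub>E I\<in>vertex_subsets V l. carrier (reduced_cohomology p (full_subcomplex K I)))"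
    then have "\<exists>f. cocycle p (full_subcomplex K I) f \<and> x I = cohomology_class p (full_subcomplex K I) f"
      if "I \<in> vertex_subsets V l" for I
      using PiE_mem[OF x that] by (auto simp: carrier_reduced_cohomology)
    then obtain F where F: "\<And>I. I \<in> vertex_subsets V l \<Longrightarrow> cocycle p (full_subcomplex K I) (F I)"
        "\<And>I. I \<in> vertex_subsets V l \<Longrightarrow> x I = cohomology_class p (full_subcomplex K I) (F I)"
      by metis
    have "x = family_class V K p l F"
      using x F(2) by (intro extensionalityI[of _ "vertex_subsets V l"]) (auto simp: family_class_def PiE_def)
    then show "x \<in> family_class V K p l ` {F. cocycle_family V K p l F}"
      using F(1) by (auto simp: cocycle_family_def)
  next
    fix x assume "x \<in> family_class V K p l ` {F. cocycle_family V K p l F}"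
    then show "x \<in> (\<Pi>\<^sub>E I\<in>vertex_subsets V l. carrier (reduced_cohomology p (full_subcomplex K I)))"
      by (auto simp: family_class_def cocycle_family_def carrier_reduced_cohomology)
  qed
  finally show ?thesis .
qed

lemma mult_family_class:
  assumes "cocycle_family V K p l F" "cocycle_family V K p l G"
  shows "family_class V K p l F \<otimes>\<^bsub>moment_angle_cohomology V K k l\<^esub> family_class V K p l G =
    family_class V K p l (\<lambda>I s. F I s + G I s)"
  using assms unfolding moment_angle_cohomology_def p
  by (auto simp: family_class_def restrict_eq_iff cocycle_family_def mult_cohomology_class)

lemma one_moment_angle_cohomology:
  "\<one>\<^bsub>moment_angle_cohomology V K k l\<^esub> = family_class V K p l (\<lambda>I s. 0)"
  unfolding moment_angle_cohomology_def p
  by (simp add: family_class_def one_reduced_cohomology)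

lemma family_class_eq_iff:
  "family_class V K p l F = family_class V K p l G \<longleftrightarrow>
    cobounding_family V K p l (\<lambda>I s. F I s - G I s)"
  by (simp add: family_class_def restrict_eq_iff cobounding_family_def cohomology_class_eq_iff)

lemma comm_group_moment_angle_cohomology: "comm_group (moment_angle_cohomology V K k l)"
proof (rule group.group_comm_groupI)
  show "group (moment_angle_cohomology V K k l)"
    by (simp add: moment_angle_cohomology_def group_reduced_cohomology_full)
qed (auto simp: carrier_moment_angle_cohomology mult_family_class add.commute)

text \<open>On representatives, inclusions induce the identity, powers become multiples and the product of
  classes becomes a sum; what remains is \<open>vertex_deletion\<close> and the overall sign.\<close>

lemma double_differential_family_class:
  assumes "cocycle_family V K p l F"
  shows "double_differential V K k l (family_class V K p l F) =
    family_class V K p (l - 1) (\<lambda>J s. (- 1) ^ nat (p + 1) * vertex_deletion V F J s)"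
  unfolding double_differential_def Let_def p family_class_def
proof (rule restrict_ext)
  fix J assume J: "J \<in> vertex_subsets V (l - 1)"
  let ?L = "full_subcomplex K J"
  define e where "e i = (- 1) ^ nat (p + 1) * vertex_sign i (insert i J)" for i
  define f where "f i s = e i * F (insert i J) s" for i s
  interpret R: comm_group "reduced_cohomology p ?L"
    by (rule comm_group_reduced_cohomology) simp
  have term_eq: "induced_restriction p ?L
        ((\<lambda>I\<in>vertex_subsets V l. cohomology_class p (full_subcomplex K I) (F I)) (insert i J))
        [^]\<^bsub>reduced_cohomology p ?L\<^esub> e i = cohomology_class p ?L (f i)"
    and cocycle: "cocycle p ?L (f i)" if i: "i \<in> V - J" for i
  proof -
    have I: "insert i J \<in> vertex_subsets V l"
      using vertex_subsets_insert[OF finite_V J i] by simp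
    have sub: "?L \<subseteq> full_subcomplex K (insert i J)"
      by (rule full_subcomplex_mono) auto
    have cyc: "cocycle p ?L (F (insert i J))"
      using assms I cocycle_mono[OF _ sub] by (simp add: cocycle_family_def)
    show "induced_restriction p ?L
        ((\<lambda>I\<in>vertex_subsets V l. cohomology_class p (full_subcomplex K I) (F I)) (insert i J))
        [^]\<^bsub>reduced_cohomology p ?L\<^esub> e i = cohomology_class p ?L (f i)"
      using I sub by (simp add: induced_restriction_cohomology_class int_pow_cohomology_class cyc f_def[abs_def])
    show "cocycle p ?L (f i)"
      using cyc by (simp add: f_def[abs_def] cocycle_scale)
  qed
  have "finprod (reduced_cohomology p ?L) (\<lambda>i. induced_restriction p ?L
        ((\<lambda>I\<in>vertex_subsets V l. cohomology_class p (full_subcomplex K I) (F I)) (insert i J))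
        [^]\<^bsub>reduced_cohomology p ?L\<^esub> e i) (V - J) =
      finprod (reduced_cohomology p ?L) (\<lambda>i. cohomology_class p ?L (f i)) (V - J)"
    by (rule R.finprod_cong'[OF refl _ term_eq]) (auto simp: cocycle cohomology_class_closed)
  also have "\<dots> = cohomology_class p ?L (\<lambda>s. \<Sum>i\<in>V - J. f i s)"
    using finite_V cocycle by (intro finprod_cohomology_class) auto
  also have "(\<lambda>s. \<Sum>i\<in>V - J. f i s) = (\<lambda>s. (- 1) ^ nat (p + 1) * vertex_deletion V F J s)"
    by (simp add: f_def e_def vertex_deletion_def sum_distrib_left mult.assoc)
  finally show "finprod (reduced_cohomology p ?L) (\<lambda>i. induced_restriction p ?L
        ((\<lambda>I\<in>vertex_subsets V l. cohomology_class p (full_subcomplex K I) (F I)) (insert i J))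
        [^]\<^bsub>reduced_cohomology p ?L\<^esub> ((- 1) ^ nat (p + 1) * vertex_sign i (insert i J))) (V - J) =
      cohomology_class p ?L (\<lambda>s. (- 1) ^ nat (p + 1) * vertex_deletion V F J s)"
    by (simp add: e_def)
qed

end

lemma cocycle_family_scaled_deletion:
  "cocycle_family V K p l F \<Longrightarrow> cocycle_family V K p (l - 1) (\<lambda>J s. c * vertex_deletion V F J s)"
  using cocycle_family_vertex_deletion[OF finite_V] by (simp add: cocycle_family_def cocycle_scale)

lemma double_differential_hom:
  assumes p: "l - k - 1 = p"
  shows "double_differential V K k l \<in>
    hom (moment_angle_cohomology V K k l) (moment_angle_cohomology V K (k - 1) (l - 1))"
proof -
  have p': "(l - 1) - (k - 1) - 1 = p" using p by simp
  have add: "cocycle_family V K p l (\<lambda>I s. F I s + G I s)"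
    if "cocycle_family V K p l F" "cocycle_family V K p l G" for F G
    using that by (simp add: cocycle_family_def cocycle_add)
  show ?thesis
    by (rule homI)
      (auto simp: carrier_moment_angle_cohomology[OF p] carrier_moment_angle_cohomology[OF p']
        double_differential_family_class[OF p] mult_family_class[OF p] mult_family_class[OF p'] add
        cocycle_family_scaled_deletion vertex_deletion_add distrib_left)
qed

lemma double_differential_eq_one_iff:
  assumes p: "l - k - 1 = p" and F: "cocycle_family V K p l F"
  shows "double_differential V K k l (family_class V K p l F) =
      \<one>\<^bsub>moment_angle_cohomology V K (k - 1) (l - 1)\<^esub> \<longleftrightarrow>
    cobounding_family V K p (l - 1) (vertex_deletion V F)"
proof -
  have p': "(l - 1) - (k - 1) - 1 = p" using p by simp
  let ?c = "(- 1) ^ nat (p + 1) :: int"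
  have "?c * ?c = 1" by (simp flip: power_add mult_2)
  then have c: "?c * (?c * x) = x" for x by (simp flip: mult.assoc)
  have "cobounding q L (\<lambda>s. ?c * f s) \<longleftrightarrow> cobounding q L f" for q L and f :: "'a set \<Rightarrow> int"
    using cobounding_scale[of q L f ?c] cobounding_scale[of q L "\<lambda>s. ?c * f s" ?c] by (auto simp only: c)
  then show ?thesis
    unfolding double_differential_family_class[OF p F] one_moment_angle_cohomology[OF p']
      family_class_eq_iff[OF p'] by (simp add: cobounding_family_def)
qed

lemma three_term_complex_moment_angle:
  assumes p: "l - k - 1 = p"
  shows "three_term_complex
    (moment_angle_cohomology V K (k + 1) (l + 1)) (double_differential V K (k + 1) (l + 1))
    (moment_angle_cohomology V K k l) (double_differential V K k l)
    (moment_angle_cohomology V K (k - 1) (l - 1))"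
proof (rule three_term_complex.intro)
  have p1: "(l + 1) - (k + 1) - 1 = p" and p2: "(l - 1) - (k - 1) - 1 = p" using p by auto
  show "group (moment_angle_cohomology V K (k + 1) (l + 1))"
    by (rule comm_group.axioms(2)[OF comm_group_moment_angle_cohomology[OF p1]])
  show "comm_group (moment_angle_cohomology V K k l)"
    by (rule comm_group_moment_angle_cohomology[OF p])
  show "group (moment_angle_cohomology V K (k - 1) (l - 1))"
    by (rule comm_group.axioms(2)[OF comm_group_moment_angle_cohomology[OF p2]])
  show "double_differential V K (k + 1) (l + 1) \<in>
      hom (moment_angle_cohomology V K (k + 1) (l + 1)) (moment_angle_cohomology V K k l)"
    using double_differential_hom[OF p1] by simp
  show "double_differential V K k l \<in>
      hom (moment_angle_cohomology V K k l) (moment_angle_cohomology V K (k - 1) (l - 1))"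
    by (rule double_differential_hom[OF p])
  fix x assume "x \<in> carrier (moment_angle_cohomology V K (k + 1) (l + 1))"
  then obtain G where G: "cocycle_family V K p (l + 1) G" and x: "x = family_class V K p (l + 1) G"
    by (auto simp: carrier_moment_angle_cohomology[OF p1])
  let ?F = "\<lambda>J s. (- 1) ^ nat (p + 1) * vertex_deletion V G J s"
  have F: "cocycle_family V K p l ?F"
    using cocycle_family_scaled_deletion[OF G] by simp
  have "cobounding_family V K p (l - 1) (vertex_deletion V ?F)"
    by (simp add: cobounding_family_def vertex_deletion_scale[abs_def] vertex_deletion_vertex_deletion
        finite_V vertex_subsets_def)
  then show "double_differential V K k l (double_differential V K (k + 1) (l + 1) x) =
      \<one>\<^bsub>moment_angle_cohomology V K (k - 1) (l - 1)\<^esub>"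
    using double_differential_eq_one_iff[OF p F] by (simp add: x double_differential_family_class[OF p1 G])
qed

lemma family_class_in_image_iff:
  assumes p: "l - k - 1 = p"
  shows "family_class V K p l F \<in> double_differential V K (k + 1) (l + 1) `
      carrier (moment_angle_cohomology V K (k + 1) (l + 1)) \<longleftrightarrow>
    (\<exists>G. cocycle_family V K p (l + 1) G \<and>
      cobounding_family V K p l (\<lambda>I s. F I s - vertex_deletion V G I s))"
proof -
  have p1: "(l + 1) - (k + 1) - 1 = p" using p by auto
  let ?c = "(- 1) ^ nat (p + 1) :: int"
  have "?c * ?c = 1" by (simp flip: power_add mult_2)
  then have c: "?c * (?c * x) = x" for x by (simp flip: mult.assoc)
  have scale: "cocycle_family V K p (l + 1) (\<lambda>I s. ?c * G I s)" if "cocycle_family V K p (l + 1) G" for G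
    using that by (simp add: cocycle_family_def cocycle_scale)
  show ?thesis
  proof
    assume "family_class V K p l F \<in> double_differential V K (k + 1) (l + 1) `
      carrier (moment_angle_cohomology V K (k + 1) (l + 1))"
    then obtain G where G: "cocycle_family V K p (l + 1) G"
      "family_class V K p l F = family_class V K p l (\<lambda>J s. ?c * vertex_deletion V G J s)"
      by (auto simp: carrier_moment_angle_cohomology[OF p1] double_differential_family_class[OF p1])
    then have "cobounding_family V K p l (\<lambda>I s. F I s - vertex_deletion V (\<lambda>I s. ?c * G I s) I s)"
      by (simp add: family_class_eq_iff[OF p] vertex_deletion_scale)
    then show "\<exists>G. cocycle_family V K p (l + 1) G \<and>
      cobounding_family V K p l (\<lambda>I s. F I s - vertex_deletion V G I s)"
      using scale[OF G(1)] by blast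
  next
    assume "\<exists>G. cocycle_family V K p (l + 1) G \<and>
      cobounding_family V K p l (\<lambda>I s. F I s - vertex_deletion V G I s)"
    then obtain G where G: "cocycle_family V K p (l + 1) G"
      "cobounding_family V K p l (\<lambda>I s. F I s - vertex_deletion V G I s)" by blast
    have "double_differential V K (k + 1) (l + 1) (family_class V K p (l + 1) (\<lambda>I s. ?c * G I s)) =
        family_class V K p l F"
      using G(2) unfolding double_differential_family_class[OF p1 scale[OF G(1)]]
      by (simp add: vertex_deletion_scale c) (metis family_class_eq_iff[OF p])
    then show "family_class V K p l F \<in> double_differential V K (k + 1) (l + 1) `
      carrier (moment_angle_cohomology V K (k + 1) (l + 1))"
      using scale[OF G(1)] by (force simp: carrier_moment_angle_cohomology[OF p1])
  qed
qed

lemma trivial_double_cohomology: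
  assumes p: "l - k - 1 = p"
    and exact: "\<And>F. cocycle_family V K p l F \<Longrightarrow> cobounding_family V K p (l - 1) (vertex_deletion V F) \<Longrightarrow>
      \<exists>G. cocycle_family V K p (l + 1) G \<and>
        cobounding_family V K p l (\<lambda>I s. F I s - vertex_deletion V G I s)"
  shows "trivial_group (double_cohomology V K k l)"
  unfolding double_cohomology_def
proof (rule three_term_complex.trivial_group_M[OF three_term_complex_moment_angle[OF p]])
  fix b assume b: "b \<in> carrier (moment_angle_cohomology V K k l)"
    "double_differential V K k l b = \<one>\<^bsub>moment_angle_cohomology V K (k - 1) (l - 1)\<^esub>"
  then obtain F where F: "cocycle_family V K p l F" "b = family_class V K p l F"
    by (auto simp: carrier_moment_angle_cohomology[OF p])
  then show "b \<in> double_differential V K (k + 1) (l + 1) `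
      carrier (moment_angle_cohomology V K (k + 1) (l + 1))"
    using b(2) exact double_differential_eq_one_iff[OF p F(1)] family_class_in_image_iff[OF p] by blast
qed

text \<open>The isomorphism is induced by an additive invariant \<open>\<Phi>\<close> of representatives that is zero on
  boundaries of both kinds, hence well defined on double cohomology. It is onto because it takes the
  value \<open>1\<close> on some cycle, and injective by exactness on its zero set.\<close>

lemma double_cohomology_iso_integer_group:
  fixes \<Phi> :: "('a set \<Rightarrow> 'a set \<Rightarrow> int) \<Rightarrow> int"
  assumes p: "l - k - 1 = p"
    and add: "\<And>F G. \<Phi> (\<lambda>I s. F I s + G I s) = \<Phi> F + \<Phi> G"
    and cobounding: "\<And>F. cobounding_family V K p l F \<Longrightarrow> \<Phi> F = 0"
    and deletion: "\<And>G. cocycle_family V K p (l + 1) G \<Longrightarrow> \<Phi> (vertex_deletion V G) = 0"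
    and exact: "\<And>F. cocycle_family V K p l F \<Longrightarrow> cobounding_family V K p (l - 1) (vertex_deletion V F) \<Longrightarrow>
      \<Phi> F = 0 \<Longrightarrow> \<exists>G. cocycle_family V K p (l + 1) G \<and>
        cobounding_family V K p l (\<lambda>I s. F I s - vertex_deletion V G I s)"
    and unit: "cocycle_family V K p l E" "cobounding_family V K p (l - 1) (vertex_deletion V E)" "\<Phi> E = 1"
  shows "double_cohomology V K k l \<cong> integer_group"
proof -
  have p1: "(l + 1) - (k + 1) - 1 = p" using p by auto
  have diff: "\<Phi> F = \<Phi> G" if "cobounding_family V K p l (\<lambda>I s. F I s - G I s)" for F G
    using cobounding[OF that] add[of "\<lambda>I s. F I s - G I s" G] by simp
  \<comment> \<open>Any representative will do: two of them differ by a cobounding family, on which \<open>\<Phi>\<close> is zero.\<close>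
  define h where "h x = \<Phi> (SOME F. x = family_class V K p l F)" for x
  have h: "h (family_class V K p l F) = \<Phi> F" for F
  proof -
    have "family_class V K p l F = family_class V K p l (SOME G. family_class V K p l F = family_class V K p l G)"
      by (rule someI[of _ F]) simp
    then show ?thesis
      unfolding h_def using diff[of F] family_class_eq_iff[OF p, of F] by metis
  qed
  show ?thesis
    unfolding double_cohomology_def
  proof (rule three_term_complex.iso_M[OF three_term_complex_moment_angle[OF p], where h = h])
    show "h \<in> hom (moment_angle_cohomology V K k l) integer_group"
      by (rule homI) (auto simp: carrier_moment_angle_cohomology[OF p] mult_family_class[OF p] h add)
  next
    fix a assume "a \<in> carrier (moment_angle_cohomology V K (k + 1) (l + 1))"
    then obtain G where G: "cocycle_family V K p (l + 1) G" "a = family_class V K p (l + 1) G"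
      by (auto simp: carrier_moment_angle_cohomology[OF p1])
    \<comment> \<open>Moving the overall sign into the family makes the image a value of \<open>vertex_deletion\<close>.\<close>
    let ?G = "\<lambda>I s. (- 1) ^ nat (p + 1) * G I s"
    have "cocycle_family V K p (l + 1) ?G"
      using G(1) by (simp add: cocycle_family_def cocycle_scale)
    then have "\<Phi> (vertex_deletion V ?G) = 0" by (rule deletion)
    moreover have "double_differential V K (k + 1) (l + 1) a = family_class V K p l (vertex_deletion V ?G)"
      by (simp add: G double_differential_family_class[OF p1 G(1)] vertex_deletion_scale[abs_def])
    ultimately show "h (double_differential V K (k + 1) (l + 1) a) = \<one>\<^bsub>integer_group\<^esub>"
      by (simp add: h)
  next
    fix b assume b: "b \<in> carrier (moment_angle_cohomology V K k l)"
      "double_differential V K k l b = \<one>\<^bsub>moment_angle_cohomology V K (k - 1) (l - 1)\<^esub>"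
      "h b = \<one>\<^bsub>integer_group\<^esub>"
    then obtain F where F: "cocycle_family V K p l F" "b = family_class V K p l F"
      by (auto simp: carrier_moment_angle_cohomology[OF p])
    then have "cobounding_family V K p (l - 1) (vertex_deletion V F)" "\<Phi> F = 0"
      using b(2,3) double_differential_eq_one_iff[OF p F(1)] by (simp_all add: h)
    then show "b \<in> double_differential V K (k + 1) (l + 1) `
        carrier (moment_angle_cohomology V K (k + 1) (l + 1))"
      using exact[OF F(1)] F(2) family_class_in_image_iff[OF p] by blast
  next
    have "\<exists>x\<in>kernel (moment_angle_cohomology V K k l) (moment_angle_cohomology V K (k - 1) (l - 1))
        (double_differential V K k l). h x = n" for n
    proof -
      interpret T: three_term_complex
        "moment_angle_cohomology V K (k + 1) (l + 1)" "double_differential V K (k + 1) (l + 1)"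
        "moment_angle_cohomology V K k l" "double_differential V K k l"
        "moment_angle_cohomology V K (k - 1) (l - 1)"
        by (rule three_term_complex_moment_angle[OF p])
      have E: "family_class V K p l E \<in> T.Ker"
        using unit double_differential_eq_one_iff[OF p unit(1)]
        by (simp add: kernel_def carrier_moment_angle_cohomology[OF p])
      have hom: "h \<in> hom T.ZB integer_group"
        by (rule T.B.hom_from_subgroup_generated, rule homI)
          (auto simp: carrier_moment_angle_cohomology[OF p] mult_family_class[OF p] h add)
      have "h (family_class V K p l E [^]\<^bsub>T.ZB\<^esub> n) = n"
        using hom_int_pow[OF hom, of "family_class V K p l E" n] E T.ZB.is_group
        by (simp add: h unit(3))
      moreover have "family_class V K p l E [^]\<^bsub>T.ZB\<^esub> n \<in> T.Ker"
        using T.ZB.int_pow_closed[of "family_class V K p l E" n] E by simp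
      ultimately show ?thesis by blast
    qed
    then show "h ` kernel (moment_angle_cohomology V K k l) (moment_angle_cohomology V K (k - 1) (l - 1))
        (double_differential V K k l) = carrier integer_group"
      by (auto simp: image_iff) metis
  qed simp
qed

text \<open>In degree \<open>- 1\<close> the empty full subcomplex is the only one with nonzero cohomology, since every
  nonempty one has a vertex; the value at the empty simplex identifies it with the integers.\<close>

lemma double_cohomology_0_0: "double_cohomology V K 0 0 \<cong> integer_group"
proof (rule double_cohomology_iso_integer_group[where p = "- 1" and \<Phi> = "\<lambda>F. F {} {}" and E = "\<lambda>I s. 1"])
  have empty: "vertex_subsets V 0 = {{}}"
    using finite_V by (auto simp: vertex_subsets_def finite_subset)
  have none: "vertex_subsets V (0 - 1) = {}"
    by (auto simp: vertex_subsets_def)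
  have emp: "{} \<in> simplices (- 1) (full_subcomplex K {})"
    using complex by (simp add: simplices_def full_subcomplex_def simplicial_complex_on_def)
  {
    fix F :: "'a set \<Rightarrow> 'a set \<Rightarrow> int" assume F: "F {} {} = 0"
    show "\<exists>G. cocycle_family V K (- 1) (0 + 1) G \<and>
      cobounding_family V K (- 1) 0 (\<lambda>I s. F I s - vertex_deletion V G I s)"
    proof (intro exI conjI)
      show "cocycle_family V K (- 1) (0 + 1) (\<lambda>I s. 0)"
        by (simp add: cocycle_family_def)
      have "\<forall>s\<in>simplices (- 1) (full_subcomplex K {}). F {} s = delta (\<lambda>s. 0) s"
        using F by (auto simp: simplices_def full_subcomplex_def)
      then have "cobounding (- 1) (full_subcomplex K {}) (F {})"
        unfolding cobounding_def by blast
      then show "cobounding_family V K (- 1) 0 (\<lambda>I s. F I s - vertex_deletion V (\<lambda>I s. 0) I s)"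
        by (simp add: cobounding_family_def empty vertex_deletion_def)
    qed
  next
    fix F assume "cobounding_family V K (- 1) 0 F"
    then show "F {} {} = 0"
      using emp by (auto simp: cobounding_family_def empty cobounding_def)
  next
    fix G assume G: "cocycle_family V K (- 1) (0 + 1) G"
    have "G {i} {} = 0" if "i \<in> V" for i
    proof -
      have "{i} \<in> simplices (- 1 + 1) (full_subcomplex K {i})" "{i} \<in> vertex_subsets V (0 + 1)"
        using singleton_in_full[of i "{i}"] that by (auto simp: simplices_def vertex_subsets_def)
      then show ?thesis
        using G unfolding cocycle_family_def cocycle_def by (metis delta_singleton)
    qed
    then show "vertex_deletion V G {} {} = 0"
      by (simp add: vertex_deletion_def)
  next
    show "cocycle_family V K (- 1) 0 (\<lambda>I s. 1)"
      by (auto simp: cocycle_family_def empty cocycle_def simplices_def full_subcomplex_def)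
  next
    show "cobounding_family V K (- 1) (0 - 1) (vertex_deletion V (\<lambda>I s. 1))"
      by (simp add: cobounding_family_def none del: diff_0)
  }
qed auto

end


section \<open>Gluing a simplex along a proper face\<close>

theorem theorem6p7:
  fixes V' D \<sigma> :: "'a::linorder set" and K' K :: "'a set set" and n :: nat
  assumes "simplicial_complex_on V' K'" and "V' \<noteq> {}"
    and "finite D" and "card D = n + 1"
    and "\<sigma> \<in> K'" and "\<sigma> \<subset> D" and "K' \<inter> Pow D = Pow \<sigma>"
    and "K = K' \<union> Pow D"
  shows "is_simplex_on (V' \<union> D) K \<or>
    (\<forall>k l :: int.
       if (k, l) = (0, 0) \<or> (k, l) = (1, 2)
       then double_cohomology (V' \<union> D) K k l \<cong> integer_group
       else trivial_group (double_cohomology (V' \<union> D) K k l))"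
proof (cases "V' \<subseteq> D")
  case True
  then show ?thesis
    using assms(8) by (auto simp: is_simplex_on_def)
next
  case False
  then obtain w where w: "w \<in> V'" "w \<notin> D" by blast
  \<comment> \<open>As \<open>\<sigma>\<close> is a proper face there is a vertex \<open>v\<close> of the new simplex outside it. The
    simplices containing \<open>v\<close> all lie in \<open>D\<close>, because \<open>v\<close> cannot be a vertex of \<open>K'\<close>.\<close>
  obtain v where v: "v \<in> D" "v \<notin> \<sigma>" using assms(6) by blast
  let ?V = "V' \<union> D"
  have K': "finite V'" "\<And>s. s \<in> K' \<Longrightarrow> s \<subseteq> V'" "{} \<in> K'" "\<And>x. x \<in> V' \<Longrightarrow> {x} \<in> K'"
    "\<And>s t. s \<in> K' \<Longrightarrow> t \<subseteq> s \<Longrightarrow> t \<in> K'"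
    using assms(1) unfolding simplicial_complex_on_def by auto
  have v_new: "v \<notin> V'"
  proof
    assume "v \<in> V'"
    then have "{v} \<in> K' \<inter> Pow D" using K'(4) v(1) by simp
    then show False using assms(7) v(2) by simp
  qed
  have complex: "simplicial_complex_on ?V K"
    unfolding simplicial_complex_on_def assms(8) using K' assms(3) by blast
  interpret S: simplicial_star ?V K v "D - {v}"
  proof
    show "simplicial_complex_on ?V K" by (rule complex)
    show "insert v (D - {v}) \<in> K" using v(1) assms(8) by (auto simp: insert_absorb)
    fix s assume "s \<in> K" "v \<in> s"
    then show "s \<subseteq> insert v (D - {v})" using K'(2) v_new assms(8) by blast
  qed auto
  have w': "w \<in> ?V" "w \<notin> insert v (D - {v})" using w v(1) by auto
  have "double_cohomology ?V K 0 0 \<cong> integer_group"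
    by (rule S.double_cohomology_0_0)
  moreover have "double_cohomology ?V K 1 2 \<cong> integer_group"
  proof -
    obtain E where E: "cocycle_family ?V K 0 2 E" "edge_invariant ?V E = 1"
      using S.edge_invariant_realizes_1[OF w'] by blast
    show ?thesis
    proof (rule S.double_cohomology_iso_integer_group[where p = 0 and \<Phi> = "edge_invariant ?V" and E = E])
      fix F assume "cocycle_family ?V K 0 2 F" "cobounding_family ?V K 0 (2 - 1) (vertex_deletion ?V F)"
        "edge_invariant ?V F = 0"
      then show "\<exists>G. cocycle_family ?V K 0 (2 + 1) G \<and>
          cobounding_family ?V K 0 2 (\<lambda>I s. F I s - vertex_deletion ?V G I s)"
        by (intro S.double_complex_exact[OF w']) auto
    next
      show "cobounding_family ?V K 0 (2 - 1) (vertex_deletion ?V E)"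
        using S.cobounding_family_singletons by simp
    qed (use E edge_invariant_add edge_invariant_cobounding_family[OF complex]
          edge_invariant_vertex_deletion[OF S.finite_V] in auto)
  qed
  moreover have "trivial_group (double_cohomology ?V K k l)" if kl: "(k, l) \<noteq> (0, 0)" "(k, l) \<noteq> (1, 2)" for k l
  proof (rule S.trivial_double_cohomology[OF refl])
    fix F assume "cocycle_family ?V K (l - k - 1) l F"
      "cobounding_family ?V K (l - k - 1) (l - 1) (vertex_deletion ?V F)"
    then show "\<exists>G. cocycle_family ?V K (l - k - 1) (l + 1) G \<and>
        cobounding_family ?V K (l - k - 1) l (\<lambda>I s. F I s - vertex_deletion ?V G I s)"
      by (rule S.double_complex_exact[OF w']) (use kl in auto)
  qed
  ultimately show ?thesis by auto
qed

end
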